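(* Let $\Theta^{\prime}=\{\theta=(\varsigma,q)\in\Theta_{(r)}:\ \tau_\varsigma(2)\ge1,\ \tau_\varsigma(1)>2\}$ and, for $\theta\in\Theta'$, let $\Theta'[\theta]=\{\theta'\in\Theta':\ \mathfrak z(\theta')>\mathfrak z(\theta)\}$. For any $\theta\in\Theta'$, any $\theta'\in\Theta'[\theta]$, any $\alpha\in(\mathfrak z(\theta),\mathfrak z(\theta'))$, and any $\vartheta=(\theta,\bar\theta)$, $\vartheta'=(\theta',\bar\theta')$ with $\bar\theta,\bar\theta'\in\Theta_{(c)}$, $$\liminf_{n\to\infty}\inf_{\widetilde N_n}\Big\{n^{2\alpha}\,\mathcal R_n^2\big[\widetilde N_n,\mathcal F_{\vartheta'}\big]+\Big(\tfrac{\sqrt{\ln n}}{n}\Big)^{-2\mathfrak z(\theta)}\mathcal R_n^2\big[\widetilde N_n,\mathcal F_{\vartheta}\big]\Big\}>0,$$ where the infimum is over all estimators.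
   Context: Model. $d\ge1$; one observes $X_1,\dots,X_n$ i.i.d. random vectors in $\mathbb R^d$ with density $f$ with respect to Lebesgue measure; $\mathbb E_f$ is expectation under the law of $(X_1,\dots,X_n)$. The functional to be estimated is $\|f\|_2$. An estimator $\widetilde N_n$ is any measurable real function of $(X_1,\dots,X_n)$. For a class $\mathbb F$ of functions (always understood as the probability densities with finite $\mathbb L_2$-norm belonging to it) put $\mathcal R_n[\widetilde N_n,\mathbb F]=\sup_{f\in\mathbb F}\big(\mathbb E_f[\widetilde N_n-\|f\|_2]^2\big)^{1/2}$. Parameters and classes. $\Theta_{(r)}=(0,\infty)^d\times[1,\infty]^d\times[2,\infty]$ with elements $\theta=(\varsigma,q)$, $\varsigma=(\vec\beta,\vec r)$; $\Theta_{(c)}=(0,\infty)^d\times(0,\infty)$ with elements $\bar\theta=(\vec L,Q)$; $\vartheta=(\theta,\bar\theta)$ and $\mathcal F_\vartheta=\mathbb N_{\vec r,d}(\vec\beta,\vec L)\cap\mathbb B_q(Q)$. Here $\mathbb B_q(Q)=\{f:\mathbb R^d\to\mathbb R:\|f\|_q\le Q\}$. Let $(e_1,\dots,e_d)$ be the canonical basis, $\Delta_{u,j}G(x)=G(x+ue_j)-G(x)$ and $\Delta^k_{u,j}=\Delta_{u,j}\Delta^{k-1}_{u,j}$. The anisotropic Nikolskii class $\mathbb N_{\vec r,d}(\vec\beta,\vec L)$ is the set of $G:\mathbb R^d\to\mathbb R$ such that $\|G\|_{r_j}\le L_j$ for all $j$ and there exist natural numbers $k_j>\beta_j$ with $\|\Delta^{k_j}_{u,j}G\|_{r_j}\le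 L_j|u|^{\beta_j}$ for all $u\in\mathbb R$, $j=1,\dots,d$. Exponents. $\frac1\beta=\sum_j\frac1{\beta_j}$, $\frac1{\omega_\varsigma}=\sum_j\frac1{\beta_jr_j}$, $\tau_\varsigma(s)=1-\frac1{\omega_\varsigma}+\frac1{\beta s}$, $s\in[1,\infty]$. $\mathfrak z(\theta)=\frac12\wedge\frac1{\tau_\varsigma(1)}$ if $\tau_\varsigma(2)\ge1$; $\mathfrak z(\theta)=\frac{1-2/q}{2-2/q-\tau_\varsigma(q)}$ if $\tau_\varsigma(2)<1$, $\tau_\varsigma(q)<0$; $\mathfrak z(\theta)=\frac12\wedge\frac{\tau_\varsigma(2)}{\tau_\varsigma(1)}$ if $\tau_\varsigma(2)<1$, $\tau_\varsigma(q)\ge0$. The minimax rate on $\mathcal F_\vartheta$ is $n^{-\mathfrak z(\theta)}$. Standing convention: only classes are considered on which a rate-optimal estimator exists and the minimax risk is of exact order $n^{-\mathfrak z(\theta)}$ (in particular the class is non-empty). *)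

theory Defs
  imports "HOL-Probability.Probability"
begin

text \<open>
  Exponents in \<open>[1,\<infinity>]\<close> are elements of \<^typ>\<open>ennreal\<close>, with \<^term>\<open>top\<close> in the role of \<open>\<infinity>\<close>.
  The reciprocal satisfies \<open>recip top = 0\<close>; it is only applied to exponents \<open>s \<ge> 1\<close>.
\<close>

definition recip :: "ennreal \<Rightarrow> real" where
  "recip s = enn2real (inverse s)"

text \<open>Power with an exponent \<open>a > 0\<close>.\<close>

definition ennpow :: "ennreal \<Rightarrow> real \<Rightarrow> ennreal" where
  "ennpow x a = (if x = top then top else ennreal (enn2real x powr a))"

definition Lp_norm :: "ennreal \<Rightarrow> (real^'d \<Rightarrow> real) \<Rightarrow> ennreal" where
  "Lp_norm p f =
    (if p = top then esssup lborel (\<lambda>x. ennreal \<bar>f x\<bar>)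
     else ennpow (\<integral>\<^sup>+x. ennreal (\<bar>f x\<bar> powr enn2real p) \<partial>lborel) (recip p))"

definition Lp_ball :: "ennreal \<Rightarrow> real \<Rightarrow> (real^'d \<Rightarrow> real) set" where
  "Lp_ball q Q = {f \<in> borel_measurable borel. Lp_norm q f \<le> ennreal Q}"

definition fdiff :: "real \<Rightarrow> 'd \<Rightarrow> (real^'d \<Rightarrow> real) \<Rightarrow> real^'d \<Rightarrow> real" where
  "fdiff u j G = (\<lambda>x. G (x + u *\<^sub>R axis j 1) - G x)"

definition nikolskii :: "real^'d \<Rightarrow> ennreal^'d \<Rightarrow> real^'d \<Rightarrow> (real^'d \<Rightarrow> real) set" where
  "nikolskii \<beta> r L =
    {G \<in> borel_measurable borel.
       (\<forall>j. Lp_norm (r $ j) G \<le> ennreal (L $ j)) \<and>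
       (\<exists>k :: 'd \<Rightarrow> nat. (\<forall>j. real (k j) > \<beta> $ j) \<and>
          (\<forall>u j. Lp_norm (r $ j) ((fdiff u j ^^ k j) G) \<le> ennreal (L $ j * \<bar>u\<bar> powr (\<beta> $ j))))}"

text \<open>
  \<open>\<sigma> = (\<beta>, r)\<close>, \<open>\<theta> = (\<sigma>, q)\<close>, and \<open>(L, Q)\<close> for the radii.
\<close>

type_synonym 'd smoothness = "(real^'d) \<times> (ennreal^'d)"
type_synonym 'd cls_param = "'d smoothness \<times> ennreal"
type_synonym 'd radii = "(real^'d) \<times> real"

definition Theta_r :: "'d::finite cls_param set" where
  "Theta_r = {((\<beta>, r), q). (\<forall>j. 0 < \<beta> $ j) \<and> (\<forall>j. 1 \<le> r $ j) \<and> 2 \<le> q}"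

definition Theta_c :: "'d::finite radii set" where
  "Theta_c = {(L, Q). (\<forall>j. 0 < L $ j) \<and> 0 < Q}"

fun fclass :: "'d::finite cls_param \<Rightarrow> 'd radii \<Rightarrow> (real^'d \<Rightarrow> real) set" where
  "fclass ((\<beta>, r), q) (L, Q) = nikolskii \<beta> r L \<inter> Lp_ball q Q"

text \<open>
  \<open>\<tau>\<^sub>\<sigma>(s) = 1 - 1/\<omega> + 1/(\<beta> s)\<close> with \<open>1/\<omega> = \<Sum>\<^sub>j 1/(\<beta>\<^sub>j r\<^sub>j)\<close> and \<open>1/\<beta> = \<Sum>\<^sub>j 1/\<beta>\<^sub>j\<close>.
\<close>

fun tau :: "'d::finite smoothness \<Rightarrow> ennreal \<Rightarrow> real" where
  "tau (\<beta>, r) s = 1 - (\<Sum>j\<in>UNIV. recip (r $ j) / \<beta> $ j) + (\<Sum>j\<in>UNIV. 1 / \<beta> $ j) * recip s"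

fun rate_exp :: "'d::finite cls_param \<Rightarrow> real" where
  "rate_exp (\<sigma>, q) =
    (if tau \<sigma> 2 \<ge> 1 then min (1/2) (1 / tau \<sigma> 1)
     else if tau \<sigma> q < 0 then (1 - 2 * recip q) / (2 - 2 * recip q - tau \<sigma> q)
     else min (1/2) (tau \<sigma> 2 / tau \<sigma> 1))"

definition Theta' :: "'d::finite cls_param set" where
  "Theta' = {(\<sigma>, q). (\<sigma>, q) \<in> Theta_r \<and> tau \<sigma> 2 \<ge> 1 \<and> tau \<sigma> 1 > 2}"

definition Theta'_above :: "'d::finite cls_param \<Rightarrow> 'd cls_param set" where
  "Theta'_above \<theta> = {\<theta>' \<in> Theta'. rate_exp \<theta>' > rate_exp \<theta>}"

definition L2_densities :: "(real^'d \<Rightarrow> real) set" where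
  "L2_densities = {f \<in> borel_measurable borel. (\<forall>x. 0 \<le> f x) \<and>
     (\<integral>\<^sup>+x. ennreal (f x) \<partial>lborel) = 1 \<and> Lp_norm 2 f < top}"

text \<open>The law of an i.i.d. sample \<open>X\<^sub>0, \<dots>, X\<^sub>n\<^sub>-\<^sub>1\<close> with density \<open>f\<close>.\<close>

definition sample_law :: "nat \<Rightarrow> (real^'d \<Rightarrow> real) \<Rightarrow> (nat \<Rightarrow> real^'d) measure" where
  "sample_law n f = (\<Pi>\<^sub>M i\<in>{..<n}. density lborel (\<lambda>x. ennreal (f x)))"

definition estimators :: "nat \<Rightarrow> ((nat \<Rightarrow> real^'d) \<Rightarrow> real) set" where
  "estimators n = borel_measurable (\<Pi>\<^sub>M i\<in>{..<n}. borel)"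

definition risk ::
  "nat \<Rightarrow> ((nat \<Rightarrow> real^'d) \<Rightarrow> real) \<Rightarrow> (real^'d \<Rightarrow> real) set \<Rightarrow> ennreal" where
  "risk n T F = (SUP f \<in> F \<inter> L2_densities.
     ennpow (\<integral>\<^sup>+X. ennreal ((T X - enn2real (Lp_norm 2 f))\<^sup>2) \<partial>sample_law n f) (1/2))"

text \<open>
  The minimax risk on \<open>F\<close> is of exact order \<open>n\<^bsup>-z\<^esup>\<close> and is attained, up to a constant, by some
  sequence of estimators. The lower bound forces \<open>F \<inter> L2_densities\<close> to be non-empty, since a
  supremum over the empty set is \<open>0\<close> in \<^typ>\<open>ennreal\<close>.
\<close>

definition exact_minimax_rate :: "(real^'d \<Rightarrow> real) set \<Rightarrow> real \<Rightarrow> bool" where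
  "exact_minimax_rate F z \<longleftrightarrow>
     0 < liminf (\<lambda>n. ennreal (real n powr z) * (INF T\<in>estimators n. risk n T F)) \<and>
     (\<exists>T. (\<forall>n. T n \<in> estimators n) \<and>
        limsup (\<lambda>n. ennreal (real n powr z) * risk n (T n) F) < top)"

end

theory Submission
  imports Defs "HOL-Real_Asymp.Real_Asymp"
begin

text \<open>
  A density \<open>f\<^sub>0\<close> that is constant, of height about \<open>1/V\<close>, on a cube of volume \<open>V\<close> and decays
  smoothly on the scale of the cube lies in every class once \<open>V\<close> is large, and has
  \<open>\<parallel>f\<^sub>0\<parallel>\<^sub>2\<close> of order \<open>V\<^bsup>-1/2\<^esup>\<close>. Cutting the cube into \<open>M\<close> cells and adding to \<open>f\<^sub>0\<close> in every cell
  a mean-zero bump of the same height with a random sign raises the norm by an amount of order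
  \<open>V\<^bsup>-1/2\<^esup>\<close>, while the second moment of the likelihood ratio of the mixture is at most
  \<open>exp (n\<^sup>2 / M)\<close>. The smoothness constraint allows \<open>M\<close> of order \<open>V\<^bsup>\<tau>(1)\<^esup>\<close>, so \<open>V\<close> of order
  \<open>(n\<^sup>2 / ln n)\<^bsup>1/\<tau>(1)\<^esup>\<close> makes this second moment a power of \<open>n\<close> with an arbitrarily small exponent.
  Such a power is absorbed by the gap \<open>\<alpha> > \<zz>(\<theta>)\<close> between the two normalisations, and the two
  hypotheses are separated by \<open>V\<^bsup>-1/2\<^esup>\<close>, which is of order \<open>(\<surd>(ln n) / n)\<^bsup>\<zz>(\<theta>)\<^esup>\<close>.
\<close>

subsection \<open>Smooth profiles on the line\<close>

text \<open>The comparison is lopsided. With a bounded second moment of the likelihood ratio, V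
  would be of order n^(2z), z = 1/\<tau>(1), and the logarithm would be lost. Here the moment E may
  grow, because the basic inequality bounds E times the risk at \<open>f\<^sub>0\<close> plus the
  risk over the mixture. Hence \<open>f\<^sub>0\<close> is placed in the class of \<theta>', whose
  weight n^(2\<alpha>) exceeds n^(2z) by n^\<kappa>, \<kappa> = 2(\<alpha> - z). Spending this
  surplus means E = n^\<kappa>, that is, n^2/M of order ln n. The obstacle to spreading mass out is
  an index r_j = 1: for p > 1 the L_p norm of a flat density decays with V, but its L_1 norm stays
  1. The needed bound L_j \<ge> 1 comes from the non-emptiness of the classes. Bumps sit where
  \<open>f\<^sub>0\<close> is constant, so that likelihood ratios are polynomials in the bumps; mean
  zero then removes the linear terms, and all mixture components get the same norm. The profiles are
  splines because the class speaks of differences, which for truncated powers are bounded by the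
  mean value theorem alone.\<close>

definition rdiff :: "real \<Rightarrow> (real \<Rightarrow> real) \<Rightarrow> real \<Rightarrow> real" where
  "rdiff u g = (\<lambda>x. g (x + u) - g x)"

lemma rdiff_pow_Suc:
  "(rdiff u ^^ Suc k) g x = (rdiff u ^^ k) g (x + u) - (rdiff u ^^ k) g x"
  unfolding funpow.simps o_apply by (subst rdiff_def) (rule refl)

lemma rdiff_pow_has_derivative:
  assumes "\<And>x. (G has_real_derivative g x) (at x)"
  shows "((rdiff u ^^ k) G has_real_derivative (rdiff u ^^ k) g x) (at x)"
proof (induction k arbitrary: x)
  case 0
  then show ?case using assms by simp
next
  case (Suc k)
  have "((\<lambda>x. (rdiff u ^^ k) G (x + u)) has_real_derivative (rdiff u ^^ k) g (x + u)) (at x)"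
    using Suc.IH[of "x + u"] DERIV_shift by blast
  then show ?case
    using Suc.IH[of x] unfolding rdiff_pow_Suc by (rule DERIV_diff)
qed

text \<open>Differences commute with differentiation, so by the mean value theorem one more
  difference of the antiderivative gains one factor \<open>\<bar>u\<bar>\<close>.\<close>

lemma rdiff_pow_antiderivative_bound:
  assumes "\<And>x. (G has_real_derivative g x) (at x)"
    and "\<And>x. \<bar>(rdiff u ^^ k) g x\<bar> \<le> B"
  shows "\<bar>(rdiff u ^^ Suc k) G x\<bar> \<le> B * \<bar>u\<bar>"
proof -
  let ?H = "(rdiff u ^^ k) G"
  have "norm (?H (x + u) - ?H x) \<le> B * norm ((x + u) - x)"
    by (rule field_differentiable_bound[where S = UNIV and f' = "(rdiff u ^^ k) g"])
      (use assms rdiff_pow_has_derivative[of G g] in auto)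
  then show ?thesis by (simp add: rdiff_pow_Suc del: funpow.simps)
qed

lemma rdiff_pow_bound:
  assumes "\<And>x. \<bar>g x\<bar> \<le> B"
  shows "\<bar>(rdiff u ^^ k) g x\<bar> \<le> 2 ^ k * B"
proof (induction k arbitrary: x)
  case 0
  then show ?case using assms by simp
next
  case (Suc k)
  show ?case
    using Suc.IH[of "x + u"] Suc.IH[of x] by (simp add: rdiff_pow_Suc del: funpow.simps)
qed

lemma rdiff_pow_shift:
  "(rdiff u ^^ k) (\<lambda>x. g (x + c)) = (\<lambda>x. (rdiff u ^^ k) g (x + c))"
proof (induction k)
  case (Suc k)
  show ?case by (simp add: fun_eq_iff rdiff_pow_Suc Suc.IH add_ac del: funpow.simps)
qed simp

lemma rdiff_pow_scale:
  "(rdiff u ^^ k) (\<lambda>x. g (a * x + c)) = (\<lambda>x. (rdiff (a * u) ^^ k) g (a * x + c))"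
proof (induction k)
  case (Suc k)
  show ?case
    unfolding fun_eq_iff rdiff_pow_Suc Suc.IH by (simp add: algebra_simps)
qed simp

lemma rdiff_pow_diff:
  "(rdiff u ^^ k) (\<lambda>x. g x - h x) = (\<lambda>x. (rdiff u ^^ k) g x - (rdiff u ^^ k) h x)"
proof (induction k)
  case (Suc k)
  show ?case by (simp add: fun_eq_iff rdiff_pow_Suc Suc.IH algebra_simps del: funpow.simps)
qed simp

lemma rdiff_pow_commute:
  "(rdiff u ^^ k) ((rdiff v ^^ l) g) = (rdiff v ^^ l) ((rdiff u ^^ k) g)"
proof (induction l)
  case (Suc l)
  have "(rdiff u ^^ k) (rdiff v h) = rdiff v ((rdiff u ^^ k) h)" for h
    by (simp add: rdiff_def[of v] rdiff_pow_diff rdiff_pow_shift[of _ _ _ v])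
  then show ?case by (simp add: Suc.IH)
qed simp

section \<open>Truncated powers and cumulative B-splines\<close>

definition trunc_pow :: "nat \<Rightarrow> real \<Rightarrow> real" where
  "trunc_pow k t = max 0 t ^ k / fact k"

lemma trunc_pow_has_derivative:
  assumes "k \<ge> 1"
  shows "(trunc_pow (Suc k) has_real_derivative trunc_pow k x) (at x)"
proof (cases "x = 0")
  case False
  have pow: "((\<lambda>t. t ^ Suc k / fact (Suc k)) has_real_derivative x ^ k / fact k) (at x)"
  proof -
    have "((\<lambda>t. t ^ Suc k / fact (Suc k)) has_real_derivative
        (real (Suc k) * x ^ (Suc k - Suc 0)) / fact (Suc k)) (at x)"
      by (intro DERIV_cdivide DERIV_pow)
    moreover have "(real (Suc k) * x ^ (Suc k - Suc 0)) / fact (Suc k) = x ^ k / fact k"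
      by (simp add: fact_Suc del: of_nat_Suc)
    ultimately show ?thesis by (simp only:)
  qed
  show ?thesis
  proof (cases "x > 0")
    case True
    have "(trunc_pow (Suc k) has_real_derivative x ^ k / fact k) (at x)"
      by (rule has_field_derivative_transform_within_open[OF pow, of "{0<..}"])
        (use True in \<open>auto simp: trunc_pow_def max_def\<close>)
    then show ?thesis using True by (simp add: trunc_pow_def max_def)
  next
    case neg: False
    have "((\<lambda>t::real. 0::real) has_real_derivative 0) (at x)" by simp
    then have "(trunc_pow (Suc k) has_real_derivative 0) (at x)"
      by (rule has_field_derivative_transform_within_open[of _ _ _ "{..<0}"])
        (use neg False in \<open>auto simp: trunc_pow_def max_def\<close>)
    then show ?thesis using neg False assms by (simp add: trunc_pow_def max_def power_0_left)
  qed
next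
  case True
  \<comment> \<open>At the kink the difference quotient is at most \<open>\<bar>h\<bar> ^ k\<close>,
    which tends to 0 because \<open>k \<ge> 1\<close>.\<close>
  have "((\<lambda>h. trunc_pow (Suc k) h / h) \<longlongrightarrow> 0) (at 0)"
  proof (rule Lim_null_comparison)
    have "norm (trunc_pow (Suc k) h / h) \<le> \<bar>h\<bar> ^ k" for h :: real
    proof (cases "h > 0")
      case True
      have "h ^ k / fact (Suc k) \<le> h ^ k / 1"
        using True by (intro divide_left_mono) (auto simp: fact_ge_1 simp del: fact_Suc)
      then show ?thesis using True
        by (simp add: trunc_pow_def max_def divide_simps del: fact_Suc)
    qed (simp add: trunc_pow_def max_def)
    then show "\<forall>\<^sub>F h in at 0. norm (trunc_pow (Suc k) h / h) \<le> \<bar>h\<bar> ^ k" by simp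
    have "((\<lambda>h::real. \<bar>h\<bar> ^ k) \<longlongrightarrow> \<bar>0\<bar> ^ k) (at 0)" by (intro tendsto_intros)
    moreover have "\<bar>0::real\<bar> ^ k = 0" using assms by (simp add: power_0_left)
    ultimately show "((\<lambda>h::real. \<bar>h\<bar> ^ k) \<longlongrightarrow> 0) (at 0)" by (simp only:)
  qed
  then show ?thesis using True assms
    by (simp add: has_field_derivative_iff trunc_pow_def power_0_left)
qed

text \<open>The induction starts at order 1, where \<open>max 0\<close> is 1-Lipschitz; the k-th
  derivative, which jumps at 0, never has to be formed.\<close>

lemma rdiff_trunc_pow_bound:
  assumes "k \<ge> 1"
  shows "\<bar>(rdiff u ^^ k) (trunc_pow k) x\<bar> \<le> \<bar>u\<bar> ^ k"
  using assms
proof (induction k arbitrary: x rule: dec_induct)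
  case base
  then show ?case by (auto simp: rdiff_def trunc_pow_def)
next
  case (step k)
  show ?case
    using rdiff_pow_antiderivative_bound[OF trunc_pow_has_derivative step.IH] step.hyps
    by (simp add: mult.commute)
qed

text \<open>The cumulative B-spline: the \<open>k\<close>-fold backward difference of a truncated power.\<close>

definition spline_step :: "nat \<Rightarrow> real \<Rightarrow> real" where
  "spline_step k t = (-1) ^ k * (rdiff (-1) ^^ k) (trunc_pow k) t"

text \<open>\<open>spline_step k\<close> is the distribution function of a sum of k independent
  uniform variables on [0,1]. By the mean value theorem, the value of the next spline at t is a
  value of \<open>spline_step k\<close> at some point of (t - 1, t); the range is inherited and the
  transition interval grows by one.\<close>

lemma spline_step_range:
  assumes "k \<ge> 1"
  shows "0 \<le> spline_step k t \<and> spline_step k t \<le> 1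
    \<and> (t \<le> 0 \<longrightarrow> spline_step k t = 0) \<and> (t \<ge> real k \<longrightarrow> spline_step k t = 1)"
  using assms
proof (induction k arbitrary: t rule: dec_induct)
  case base
  then show ?case by (auto simp: spline_step_def rdiff_def trunc_pow_def)
next
  case (step k)
  define F where "F t = (-1) ^ k * (rdiff (-1) ^^ k) (trunc_pow (Suc k)) t" for t
  have der: "(F has_real_derivative spline_step k t) (at t)" for t
    unfolding F_def spline_step_def
    by (intro DERIV_cmult rdiff_pow_has_derivative trunc_pow_has_derivative step.hyps)
  obtain z where z: "t - 1 < z" "z < t" "F t - F (t - 1) = (t - (t - 1)) * spline_step k z"
    using MVT2[of "t - 1" t F "spline_step k"] der by auto
  have "spline_step (Suc k) t = F t - F (t - 1)"
    by (simp add: spline_step_def F_def rdiff_pow_Suc algebra_simps del: funpow.simps)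
  then have "spline_step (Suc k) t = spline_step k z" using z by simp
  then show ?case using step.IH[of z] z by auto
qed

lemma continuous_spline_step:
  assumes "k \<ge> 1" shows "continuous_on UNIV (spline_step k)"
proof -
  have "continuous_on UNIV ((rdiff (-1) ^^ l) (trunc_pow k))" for l
  proof (induction l)
    case 0
    have "trunc_pow k = (\<lambda>t. max 0 t ^ k / fact k)" by (auto simp: trunc_pow_def)
    then show ?case by (auto intro!: continuous_intros)
  next
    case (Suc l)
    have "continuous_on UNIV (\<lambda>x. (rdiff (-1) ^^ l) (trunc_pow k) (x + -1))"
      by (rule continuous_on_compose2[OF Suc]) (auto intro!: continuous_intros)
    then show ?case using Suc unfolding rdiff_pow_Suc[abs_def] by (rule continuous_on_diff)
  qed
  then show ?thesis unfolding spline_step_def by (auto intro!: continuous_intros)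
qed

text \<open>The two kinds of differences commute: those with step u act first and give
  \<open>\<bar>u\<bar> ^ k\<close>, then each of the k unit differences at most doubles the
  bound.\<close>

lemma rdiff_spline_step_bound:
  assumes "k \<ge> 1"
  shows "\<bar>(rdiff u ^^ k) (spline_step k) x\<bar> \<le> 2 ^ k * \<bar>u\<bar> ^ k"
proof -
  have cmult: "(rdiff u ^^ l) (\<lambda>t. c * g t) = (\<lambda>t. c * (rdiff u ^^ l) g t)" for c l g
    by (induction l) (simp_all add: fun_eq_iff rdiff_pow_Suc algebra_simps del: funpow.simps(2))
  have "(rdiff u ^^ k) (spline_step k) x
      = (-1) ^ k * (rdiff (-1) ^^ k) ((rdiff u ^^ k) (trunc_pow k)) x"
    unfolding spline_step_def by (simp add: cmult rdiff_pow_commute)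
  moreover have "\<bar>(rdiff (-1) ^^ k) ((rdiff u ^^ k) (trunc_pow k)) x\<bar> \<le> 2 ^ k * \<bar>u\<bar> ^ k"
    by (rule rdiff_pow_bound) (rule rdiff_trunc_pow_bound[OF assms])
  ultimately show ?thesis by (simp add: abs_mult power_abs)
qed

text \<open>The constant is uniform over all exponents below k, so one profile and one difference
  order serve every direction of both classes.\<close>

definition holder_bound :: "nat \<Rightarrow> (real \<Rightarrow> real) \<Rightarrow> real \<Rightarrow> bool" where
  "holder_bound k g C \<longleftrightarrow>
    (\<forall>u x \<beta>. 0 < \<beta> \<longrightarrow> \<beta> < real k \<longrightarrow> \<bar>(rdiff u ^^ k) g x\<bar> \<le> C * \<bar>u\<bar> powr \<beta>)"

lemma holder_boundD:
  assumes "holder_bound k g C" "0 < \<beta>" "\<beta> < real k"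
  shows "\<bar>(rdiff u ^^ k) g x\<bar> \<le> C * \<bar>u\<bar> powr \<beta>"
  using assms unfolding holder_bound_def by blast

lemma holder_bound_affine:
  assumes "holder_bound k g C" "0 < \<beta>" "\<beta> < real k"
  shows "\<bar>(rdiff u ^^ k) (\<lambda>x. g (a * x + c)) x\<bar> \<le> C * \<bar>a * u\<bar> powr \<beta>"
  using holder_boundD[OF assms] by (simp add: rdiff_pow_scale)

text \<open>A rescaled spline \<open>s\<close> climbs from 0 to 1 on [0,1]; \<open>P\<close> is the
  difference of its two unit translates, climbing on [-1,0] and falling on [1,2].\<close>

lemma plateau_exists:
  fixes k :: nat
  assumes "k \<ge> 1"
  obtains P :: "real \<Rightarrow> real" and C where
    "continuous_on UNIV P" "\<And>t. 0 \<le> P t" "\<And>t. P t \<le> 1"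
    "\<And>t. 0 \<le> t \<Longrightarrow> t \<le> 1 \<Longrightarrow> P t = 1" "\<And>t. t \<le> -1 \<or> t \<ge> 2 \<Longrightarrow> P t = 0"
    "holder_bound k P C" "0 \<le> C"
proof -
  define s where "s t = spline_step k (real k * t)" for t
  have s: "0 \<le> s t" "s t \<le> 1" "t \<le> 0 \<Longrightarrow> s t = 0" "t \<ge> 1 \<Longrightarrow> s t = 1" for t
    using spline_step_range[OF assms, of "real k * t"] assms
    by (auto simp: s_def mult_nonneg_nonpos)
  define P where "P t = s (t + 1) - s (t - 1)" for t
  \<comment> \<open>The first summand serves steps with \<open>\<bar>u\<bar> \<ge> 1\<close>, where
    the trivial bound \<open>2 ^ k\<close> and \<open>\<bar>u\<bar> powr \<beta> \<ge> 1\<close>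
    suffice. The second serves shorter steps, where the spline bound is of order
    \<open>\<bar>u\<bar> ^ k\<close> and this is at most
    \<open>\<bar>u\<bar> powr \<beta>\<close>.\<close>
  define C where "C = (2 ^ k + (4 * real k) ^ k * 2)"
  have cont: "continuous_on UNIV P"
    unfolding P_def s_def
    by (intro continuous_intros continuous_on_compose2[OF continuous_spline_step[OF assms]]) auto
  have P01: "0 \<le> P t" "P t \<le> 1" for t
    using s(1,2)[of "t+1"] s(1,2)[of "t-1"] s(3)[of "t-1"] s(4)[of "t+1"]
    by (cases "t \<le> 1"; auto simp: P_def)+
  have "\<bar>(rdiff u ^^ k) P x\<bar> \<le> C * \<bar>u\<bar> powr \<beta>" if \<beta>: "0 < \<beta>" "\<beta> < real k" for u x \<beta>
  proof (cases "\<bar>u\<bar> \<ge> 1")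
    case True
    have "\<bar>(rdiff u ^^ k) P x\<bar> \<le> 2 ^ k * 1"
      by (rule rdiff_pow_bound) (use P01 in \<open>auto simp: abs_le_iff intro: order_trans[of _ 0]\<close>)
    also have "\<dots> \<le> C * \<bar>u\<bar> powr \<beta>"
      using True \<beta> by (intro mult_mono) (auto simp: C_def ge_one_powr_ge_zero)
    finally show ?thesis .
  next
    case False
    let ?R = "\<lambda>x. (rdiff (real k * u) ^^ k) (spline_step k) x"
    have PP: "P = (\<lambda>x. spline_step k (real k * x + real k) - spline_step k (real k * x + - real k))"
      by (auto simp: P_def s_def algebra_simps)
    have "(rdiff u ^^ k) P x = ?R (real k * x + real k) - ?R (real k * x + - real k)"
      by (simp only: PP rdiff_pow_diff rdiff_pow_scale)
    also have "\<bar>\<dots>\<bar> \<le> 2 * (2 ^ k * \<bar>real k * u\<bar> ^ k)"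
      using rdiff_spline_step_bound[OF assms, of "real k * u" "real k * x + real k"]
        rdiff_spline_step_bound[OF assms, of "real k * u" "real k * x + - real k"] by linarith
    also have "\<dots> = (2 * real k) ^ k * 2 * \<bar>u\<bar> ^ k"
      by (simp add: abs_mult power_mult_distrib)
    also have "\<dots> \<le> C * \<bar>u\<bar> powr \<beta>"
    proof (rule mult_mono)
      show "\<bar>u\<bar> ^ k \<le> \<bar>u\<bar> powr \<beta>"
      proof (cases "u = 0")
        case False
        then have "\<bar>u\<bar> ^ k = \<bar>u\<bar> powr real k" by (simp add: powr_realpow)
        also have "\<dots> \<le> \<bar>u\<bar> powr \<beta>"
          using \<beta> \<open>\<not> \<bar>u\<bar> \<ge> 1\<close> by (intro powr_mono') auto
        finally show ?thesis .
      qed (use assms in \<open>simp add: power_0_left\<close>)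
      have "(2 * real k) ^ k \<le> (4 * real k) ^ k" by (intro power_mono) auto
      moreover have "(0::real) \<le> 2 ^ k" by simp
      ultimately show "(2 * real k) ^ k * 2 \<le> C" unfolding C_def by linarith
    qed (auto simp: C_def)
    finally show ?thesis .
  qed
  then have "holder_bound k P C" unfolding holder_bound_def by blast
  moreover have "P t = 1" if "0 \<le> t" "t \<le> 1" for t
    using s(4)[of "t+1"] s(3)[of "t-1"] that by (simp add: P_def)
  moreover have "P t = 0" if "t \<le> -1 \<or> t \<ge> 2" for t
    using s(3,4)[of "t+1"] s(3,4)[of "t-1"] that by (auto simp: P_def)
  ultimately show ?thesis using that[of P C] cont P01 by (auto simp: C_def)
qed

subsection \<open>Iterated differences and membership in the classes\<close>

lemma fdiff_pow_Suc:
  "(fdiff u j ^^ Suc k) f x = (fdiff u j ^^ k) f (x + u *\<^sub>R axis j 1) - (fdiff u j ^^ k) f x"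
  unfolding funpow.simps o_apply by (subst fdiff_def) (rule refl)

lemma fdiff_pow_eq_0:
  assumes "\<And>i. i \<le> k \<Longrightarrow> f (x + (real i * u) *\<^sub>R axis j 1) = 0"
  shows "(fdiff u j ^^ k) f x = 0"
  using assms
proof (induction k arbitrary: x)
  case 0
  then show ?case by force
next
  case (Suc k)
  have "(fdiff u j ^^ k) f (x + u *\<^sub>R axis j 1) = 0"
  proof (rule Suc.IH)
    fix i assume "i \<le> k"
    then show "f (x + u *\<^sub>R axis j 1 + (real i * u) *\<^sub>R axis j 1) = 0"
      using Suc.prems[of "Suc i"] by (simp add: algebra_simps)
  qed
  moreover have "(fdiff u j ^^ k) f x = 0" using Suc by simp
  ultimately show ?case by (simp add: fdiff_pow_Suc del: funpow.simps)
qed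

lemma fdiff_pow_linear:
  assumes "finite I"
  shows "(fdiff u j ^^ k) (\<lambda>x. a * f x + (\<Sum>m\<in>I. w m * g m x))
    = (\<lambda>x. a * (fdiff u j ^^ k) f x + (\<Sum>m\<in>I. w m * (fdiff u j ^^ k) (g m) x))"
proof (induction k)
  case (Suc k)
  show ?case
    unfolding fun_eq_iff fdiff_pow_Suc Suc.IH
    by (simp add: algebra_simps sum_subtractf)
qed simp

lemma fdiff_pow_prod:
  fixes p :: "'d::finite \<Rightarrow> real \<Rightarrow> real"
  shows "(fdiff u j ^^ k) (\<lambda>x. \<Prod>i\<in>UNIV. p i (x $ i))
    = (\<lambda>x. (rdiff u ^^ k) (p j) (x $ j) * (\<Prod>i\<in>UNIV - {j}. p i (x $ i)))"
proof (induction k)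
  case 0
  show ?case by (simp add: fun_eq_iff prod.remove[of UNIV j])
next
  case (Suc k)
  have other: "(\<Prod>i\<in>UNIV - {j}. p i ((x + u *\<^sub>R axis j 1) $ i)) = (\<Prod>i\<in>UNIV - {j}. p i (x $ i))"
    for x :: "real^'d"
    by (rule prod.cong) (auto simp: axis_def)
  have coord: "(x + u *\<^sub>R axis j 1) $ j = x $ j + u" for x :: "real^'d"
    by (simp add: axis_def)
  show ?case
    unfolding fun_eq_iff fdiff_pow_Suc rdiff_pow_Suc Suc.IH other coord
    by (simp add: algebra_simps)
qed

text \<open>A shift along one axis touches one factor of the product; the other factors are bounded
  by 1, and dilating that factor by \<open>a j\<close> costs
  \<open>a j powr \<beta>\<close>.\<close>

lemma fdiff_pow_prod_holder:
  fixes p :: "'d::finite \<Rightarrow> real \<Rightarrow> real"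
  assumes "\<And>i t. \<bar>p i t\<bar> \<le> 1" and "\<And>i. holder_bound k (p i) C" and "0 \<le> C"
    and "0 < \<beta>" "\<beta> < real k" and "a j > 0"
  shows "\<bar>(fdiff u j ^^ k) (\<lambda>x. \<Prod>i\<in>UNIV. p i (a i * x $ i + c i)) x\<bar>
    \<le> C * (a j * \<bar>u\<bar>) powr \<beta>"
proof -
  let ?p = "\<lambda>i t. p i (a i * t + c i)"
  have "\<bar>\<Prod>i\<in>UNIV - {j}. ?p i (x $ i)\<bar> \<le> 1"
    unfolding abs_prod by (rule prod_le_1) (use assms in auto)
  moreover have "\<bar>(rdiff u ^^ k) (?p j) (x $ j)\<bar> \<le> C * \<bar>a j * u\<bar> powr \<beta>"
    by (rule holder_bound_affine) (use assms in auto)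
  ultimately have "\<bar>(rdiff u ^^ k) (?p j) (x $ j)\<bar> * \<bar>\<Prod>i\<in>UNIV - {j}. ?p i (x $ i)\<bar>
      \<le> (C * \<bar>a j * u\<bar> powr \<beta>) * 1"
    using assms(3) by (intro mult_mono) auto
  then show ?thesis
    using \<open>a j > 0\<close> unfolding fdiff_pow_prod[where p = ?p] by (simp add: abs_mult)
qed

lemma borel_measurable_fdiff_pow:
  fixes f :: "real^'d::finite \<Rightarrow> real"
  assumes "f \<in> borel_measurable borel"
  shows "(fdiff u j ^^ k) f \<in> borel_measurable borel"
proof (induction k)
  case (Suc k)
  have "(\<lambda>x. (fdiff u j ^^ k) f (x + u *\<^sub>R axis j 1)) \<in> borel_measurable borel"
    by (rule measurable_compose[OF _ Suc]) measurable
  then show ?case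
    using Suc unfolding fdiff_pow_Suc[abs_def] by measurable
qed (use assms in simp)

lemma emeasure_cbox_cart:
  fixes a b :: "real^'d::finite"
  assumes "\<And>i. a $ i \<le> b $ i"
  shows "emeasure lborel (cbox a b) = ennreal (\<Prod>i\<in>UNIV. b $ i - a $ i)"
proof -
  have ne: "cbox a b \<noteq> {}" using assms by (auto simp: interval_ne_empty_cart)
  have "emeasure lborel (cbox a b) = ennreal (measure lborel (cbox a b))"
    by (rule emeasure_eq_ennreal_measure) (use emeasure_lborel_cbox_finite[of a b] in auto)
  also have "measure lborel (cbox a b) = (\<Prod>i\<in>UNIV. b $ i - a $ i)"
    using content_cbox_cart[OF ne] by simp
  finally show ?thesis .
qed

text \<open>A k-th difference at x sees only the k + 1 points x + i u e_j, so its support lies in k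
  + 1 translates of the box. The resulting volume bound does not depend on u.\<close>

lemma fdiff_pow_support:
  fixes f :: "real^'d::finite \<Rightarrow> real"
  assumes "\<And>x. x \<notin> cbox lo hi \<Longrightarrow> f x = 0" and "\<And>i. lo $ i \<le> hi $ i"
    and "(\<Prod>i\<in>UNIV. hi $ i - lo $ i) \<le> v"
  obtains S where "S \<in> sets borel" "\<And>x. x \<notin> S \<Longrightarrow> (fdiff u j ^^ k) f x = 0"
    "emeasure lborel S \<le> ennreal (real (k + 1) * v)"
proof -
  define e where "e i = (real i * u) *\<^sub>R (axis j 1 :: real^'d)" for i
  define S where "S = (\<Union>i\<in>{..k}. cbox (lo - e i) (hi - e i))"
  have "(fdiff u j ^^ k) f x = 0" if "x \<notin> S" for x
  proof (rule fdiff_pow_eq_0)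
    fix i assume "i \<le> k"
    then have "x \<notin> cbox (lo - e i) (hi - e i)" using that by (auto simp: S_def)
    then have "x + e i \<notin> cbox lo hi" by (simp add: mem_box_cart algebra_simps)
    then show "f (x + (real i * u) *\<^sub>R axis j 1) = 0" using assms(1) by (simp add: e_def)
  qed
  moreover have "emeasure lborel S \<le> ennreal (real (k + 1) * v)"
  proof -
    have "emeasure lborel S \<le> (\<Sum>i\<in>{..k}. emeasure lborel (cbox (lo - e i) (hi - e i)))"
      unfolding S_def by (rule emeasure_subadditive_finite) auto
    also have "\<dots> = (\<Sum>i\<in>{..k}. ennreal (\<Prod>i\<in>UNIV. hi $ i - lo $ i))"
      using assms(2) by (intro sum.cong refl) (subst emeasure_cbox_cart, auto)
    also have "\<dots> = ennreal (real (k + 1) * (\<Prod>i\<in>UNIV. hi $ i - lo $ i))"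
    using assms(2) by (simp add: ennreal_mult prod_nonneg ennreal_of_nat_eq_real_of_nat)
    also have "\<dots> \<le> ennreal (real (k + 1) * v)"
      using assms(3) by (intro ennreal_leI mult_left_mono) auto
    finally show ?thesis .
  qed
  moreover have "S \<in> sets borel" by (auto simp: S_def)
  ultimately show ?thesis using that[of S] by blast
qed

section \<open>\<open>L\<^sub>p\<close> norms of bounded functions and a criterion for class
  membership\<close>

lemma ennpow_mono: "0 \<le> a \<Longrightarrow> x \<le> y \<Longrightarrow> ennpow x a \<le> ennpow y a"
  by (auto simp: ennpow_def top_unique less_top[symmetric] intro!: ennreal_leI powr_mono2 enn2real_mono)

lemma ennpow_ennreal: "0 \<le> x \<Longrightarrow> ennpow (ennreal x) a = ennreal (x powr a)"
  by (simp add: ennpow_def)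

lemma recip_eq_inverse: "p \<noteq> top \<Longrightarrow> 1 \<le> p \<Longrightarrow> recip p = 1 / enn2real p"
  by (cases p rule: ennreal_cases) (auto simp: recip_def inverse_ennreal divide_inverse
      simp flip: ennreal_1)

lemma Lp_norm_bounded_support:
  fixes f :: "real^'d::finite \<Rightarrow> real"
  assumes [measurable]: "f \<in> borel_measurable borel" "S \<in> sets borel"
    and "\<And>x. \<bar>f x\<bar> \<le> b" "\<And>x. x \<notin> S \<Longrightarrow> f x = 0"
    and "emeasure lborel S \<le> ennreal v" "0 < v" "1 \<le> p"
  shows "Lp_norm p f \<le> ennreal (b * v powr recip p)"
proof -
  have b: "0 \<le> b" using assms(3)[of 0] by linarith
  show ?thesis
  proof (cases "p = top")
    case True
    have "esssup lborel (\<lambda>x. ennreal \<bar>f x\<bar>) \<le> ennreal b"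
      by (rule esssup_I) (auto intro!: ennreal_leI assms(3))
    \<comment> \<open>Here \<open>recip p = 0\<close> and \<open>v powr 0 = 1\<close>; positivity of
      v matters because \<open>0 powr 0 = 0\<close>.\<close>
    then show ?thesis using True \<open>0 < v\<close> by (simp add: Lp_norm_def recip_def)
  next
    case False
    define r where "r = enn2real p"
    have r: "1 \<le> r" using False \<open>1 \<le> p\<close>
      by (cases p rule: ennreal_cases) (auto simp: r_def simp flip: ennreal_1)
    have rp: "recip p = 1 / r" using recip_eq_inverse[OF False \<open>1 \<le> p\<close>] by (simp add: r_def)
    have "(\<integral>\<^sup>+x. ennreal (\<bar>f x\<bar> powr r) \<partial>lborel) \<le> (\<integral>\<^sup>+x. ennreal (b powr r) * indicator S x \<partial>lborel)"
      by (rule nn_integral_mono)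
        (use assms(3,4) r in \<open>auto simp: indicator_def intro!: ennreal_leI powr_mono2\<close>)
    also have "\<dots> = ennreal (b powr r) * emeasure lborel S" by (rule nn_integral_cmult_indicator) simp
    also have "\<dots> \<le> ennreal (b powr r * v)"
      using assms(5) by (simp add: ennreal_mult mult_left_mono \<open>0 < v\<close> less_imp_le)
    finally have "Lp_norm p f \<le> ennpow (ennreal (b powr r * v)) (1 / r)"
      unfolding Lp_norm_def using False r rp by (auto simp: r_def intro!: ennpow_mono)
    also have "\<dots> = ennreal (b * v powr recip p)"
      using b r \<open>0 < v\<close> by (simp add: ennpow_ennreal powr_mult powr_powr rp)
    finally show ?thesis .
  qed
qed

lemma recip_simps [simp]: "recip top = 0" "recip 1 = 1" "recip 2 = 1 / 2"
  by (simp_all add: recip_eq_inverse) (simp add: recip_def)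

lemma recip_less_1:
  assumes "1 \<le> r" "r \<noteq> 1" shows "recip r < 1"
proof (cases r rule: ennreal_cases)
  case (real x)
  then have "1 < x" using assms by (auto simp: less_le simp flip: ennreal_1)
  then have "inverse x < 1" by (simp add: inverse_less_1_iff)
  then show ?thesis using real \<open>1 < x\<close> by (simp add: recip_def inverse_ennreal)
qed (simp add: recip_def)

lemma recip_le_1: "1 \<le> r \<Longrightarrow> recip r \<le> 1"
  using recip_less_1[of r] by (cases "r = 1") auto

lemma Lp_norm_1_density:
  assumes "\<And>x. 0 \<le> f x" "(\<integral>\<^sup>+x. ennreal (f x) \<partial>lborel) = 1"
  shows "Lp_norm 1 f = 1"
proof -
  have "(\<lambda>x. ennreal (\<bar>f x\<bar> powr enn2real 1)) = (\<lambda>x. ennreal (f x))"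
    using assms(1) by (simp add: fun_eq_iff)
  then show ?thesis
    using assms(2) by (simp add: Lp_norm_def ennpow_def del: nn_integral_const)
qed

lemma Lp_norm_2:
  assumes "integrable lborel (\<lambda>x. (f x)\<^sup>2)"
  shows "Lp_norm 2 f = ennreal (sqrt (LINT x|lborel. (f x)\<^sup>2))"
proof -
  have powr2_eq: "\<bar>y\<bar> powr 2 = y\<^sup>2" for y :: real
    by (cases "y = 0") auto
  have "(\<lambda>x. ennreal (\<bar>f x\<bar> powr enn2real 2)) = (\<lambda>x. ennreal ((f x)\<^sup>2))"
    by (auto simp: fun_eq_iff powr2_eq)
  then have "(\<integral>\<^sup>+x. ennreal (\<bar>f x\<bar> powr enn2real 2) \<partial>lborel) = ennreal (LINT x|lborel. (f x)\<^sup>2)"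
    using nn_integral_eq_integral[OF assms] by (simp only:) simp
  then show ?thesis
    by (simp add: Lp_norm_def ennpow_ennreal powr_half_sqrt)
qed

text \<open>Height times volume to the power 1/p does not become small for p = 1 when a density is
  spread out. The index \<open>r $ j = 1\<close> is therefore treated apart, through the exact value
  1 of the norm. For the differences no such split is made, since their height \<open>b j\<close>
  carries the smallness.\<close>

lemma fclass_L2_densities_I:
  fixes f :: "real^'d::finite \<Rightarrow> real"
  assumes f: "f \<in> borel_measurable borel" "\<And>x. 0 \<le> f x" "\<And>x. f x \<le> a"
      "(\<integral>\<^sup>+x. ennreal (f x) \<partial>lborel) = 1"
    and supp: "\<And>x. x \<notin> cbox lo hi \<Longrightarrow> f x = 0" "\<And>i. lo $ i \<le> hi $ i"
      "(\<Prod>i\<in>UNIV. hi $ i - lo $ i) \<le> v" "0 < v"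
    and r: "\<And>j. 1 \<le> r $ j" "2 \<le> q" and k: "\<And>j. \<beta> $ j < real k"
    and L1: "\<And>j. r $ j = 1 \<Longrightarrow> 1 \<le> L $ j"
    and La: "\<And>j. r $ j \<noteq> 1 \<Longrightarrow> a * v powr recip (r $ j) \<le> L $ j"
    and Qa: "a * v powr recip q \<le> Q"
    and diff: "\<And>u j x. \<bar>(fdiff u j ^^ k) f x\<bar> \<le> b j * \<bar>u\<bar> powr (\<beta> $ j)"
    and Lb: "\<And>j. b j * (real (k + 1) * v) powr recip (r $ j) \<le> L $ j"
  shows "f \<in> fclass ((\<beta>, r), q) (L, Q) \<inter> L2_densities"
proof -
  have em: "emeasure lborel (cbox lo hi) \<le> ennreal v"
    using supp by (simp add: emeasure_cbox_cart ennreal_leI)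
  have norm: "Lp_norm p f \<le> ennreal (a * v powr recip p)" if "1 \<le> p" for p
    by (rule Lp_norm_bounded_support[OF f(1) _ _ supp(1) em \<open>0 < v\<close> that]) (simp_all add: f)
  have "Lp_norm (r $ j) f \<le> ennreal (L $ j)" for j
  proof (cases "r $ j = 1")
    case True
    have "ennreal 1 \<le> ennreal (L $ j)" by (rule ennreal_leI) (rule L1[OF True])
    then show ?thesis unfolding True Lp_norm_1_density[OF f(2,4)] by (simp only: ennreal_1)
  next
    case False
    show ?thesis by (rule order_trans[OF norm[OF r(1)] ennreal_leI[OF La[OF False]]])
  qed
  moreover have "Lp_norm (r $ j) ((fdiff u j ^^ k) f) \<le> ennreal (L $ j * \<bar>u\<bar> powr (\<beta> $ j))" for u j
  proof -
    obtain S where S: "S \<in> sets borel" "\<And>x. x \<notin> S \<Longrightarrow> (fdiff u j ^^ k) f x = 0"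
      "emeasure lborel S \<le> ennreal (real (k + 1) * v)"
      by (rule fdiff_pow_support[where f = f and u = u and j = j and k = k, OF supp(1-3)])
        (assumption, rule that)
    have "Lp_norm (r $ j) ((fdiff u j ^^ k) f)
        \<le> ennreal ((b j * \<bar>u\<bar> powr (\<beta> $ j)) * (real (k + 1) * v) powr recip (r $ j))"
      by (rule Lp_norm_bounded_support[OF borel_measurable_fdiff_pow[OF f(1)] S(1) diff S(2,3)])
        (simp_all add: r \<open>0 < v\<close>)
    also have "\<dots> = ennreal ((b j * (real (k + 1) * v) powr recip (r $ j)) * \<bar>u\<bar> powr (\<beta> $ j))"
      by (simp add: mult_ac)
    also have "\<dots> \<le> ennreal (L $ j * \<bar>u\<bar> powr (\<beta> $ j))"
      by (intro ennreal_leI mult_right_mono Lb) auto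
    finally show ?thesis .
  qed
  ultimately have "f \<in> nikolskii \<beta> r L"
    unfolding nikolskii_def using f(1) k by (intro CollectI conjI exI[of _ "\<lambda>_. k"] allI) assumption+
  moreover have "1 \<le> q" by (rule order_trans[OF _ r(2)]) simp
  then have "Lp_norm q f \<le> ennreal Q"
    by (rule order_trans[OF norm ennreal_leI[OF Qa]])
  then have "f \<in> Lp_ball q Q" unfolding Lp_ball_def using f(1) by simp
  moreover have "Lp_norm 2 f < top"
    by (rule le_less_trans[OF norm ennreal_less_top]) simp
  then have "f \<in> L2_densities"
    unfolding L2_densities_def using f by blast
  ultimately show ?thesis by simp
qed

subsection \<open>Testing against a mixture\<close>

lemma sample_law_eq_density:
  fixes f :: "real^'d::finite \<Rightarrow> real"
  assumes [measurable]: "f \<in> borel_measurable borel"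
    and int: "(\<integral>\<^sup>+x. ennreal (f x) \<partial>lborel) = 1"
  shows "sample_law n f
    = density (\<Pi>\<^sub>M i\<in>{..<n}. lborel) (\<lambda>X. \<Prod>i<n. ennreal (f (X i)))"
proof -
  let ?M = "density lborel (\<lambda>x. ennreal (f x))"
  let ?P = "\<Pi>\<^sub>M i\<in>{..<n}. (lborel :: (real^'d) measure)"
  have "prob_space ?M"
    by (rule prob_spaceI) (simp add: emeasure_density int cong: nn_integral_cong)
  then interpret P: product_sigma_finite "\<lambda>_::nat. ?M"
    by (simp add: product_sigma_finite_def prob_space_imp_sigma_finite)
  interpret L: product_sigma_finite "\<lambda>_::nat. (lborel :: (real^'d) measure)"
    by standard
  have [measurable]: "(\<lambda>X. X i) \<in> ?P \<rightarrow>\<^sub>M borel" if "i \<in> {..<n}" for i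
    using measurable_component_singleton[OF that, of "\<lambda>_. lborel"] by simp
  have "density ?P (\<lambda>X. \<Prod>i<n. ennreal (f (X i))) = (\<Pi>\<^sub>M i\<in>{..<n}. ?M)"
  proof (rule P.PiM_eqI)
    show "sets (density ?P (\<lambda>X. \<Prod>i<n. ennreal (f (X i)))) = sets (\<Pi>\<^sub>M i\<in>{..<n}. ?M)"
      by (simp cong: sets_PiM_cong)
    fix A assume "\<And>i. i \<in> {..<n} \<Longrightarrow> A i \<in> sets ?M"
    then have A [measurable]: "A i \<in> sets borel" if "i < n" for i using that by simp
    have "emeasure (density ?P (\<lambda>X. \<Prod>i<n. ennreal (f (X i)))) (Pi\<^sub>E {..<n} A)
        = (\<integral>\<^sup>+X. (\<Prod>i<n. ennreal (f (X i))) * indicator (Pi\<^sub>E {..<n} A) X \<partial>?P)"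
      by (rule emeasure_density) (auto intro!: sets_PiM_I_finite A)
    also have "\<dots> = (\<integral>\<^sup>+X. (\<Prod>i<n. ennreal (f (X i)) * indicator (A i) (X i)) \<partial>?P)"
    proof (rule nn_integral_cong)
      fix X assume "X \<in> space ?P"
      \<comment> \<open>Points of the product space are extensional, so membership in the box is
        decided by the n coordinates alone.\<close>
      then have "X \<in> extensional {..<n}" by (simp add: space_PiM PiE_def)
      then have "indicator (Pi\<^sub>E {..<n} A) X = (\<Prod>i<n. indicator (A i) (X i) :: ennreal)"
        by (auto simp: indicator_def PiE_def Pi_def intro!: prod.neutral prod_zero)
      then show "(\<Prod>i<n. ennreal (f (X i))) * indicator (Pi\<^sub>E {..<n} A) X
          = (\<Prod>i<n. ennreal (f (X i)) * indicator (A i) (X i))"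
        by (simp add: prod.distrib)
    qed
    also have "\<dots> = (\<Prod>i<n. \<integral>\<^sup>+x. ennreal (f x) * indicator (A i) x \<partial>lborel)"
      by (rule L.product_nn_integral_prod) auto
    also have "\<dots> = (\<Prod>i<n. emeasure ?M (A i))"
      by (intro prod.cong refl) (simp add: emeasure_density)
    finally show "emeasure (density ?P (\<lambda>X. \<Prod>i<n. ennreal (f (X i)))) (Pi\<^sub>E {..<n} A)
      = (\<Prod>i<n. emeasure ?M (A i))" .
  qed simp
  then show ?thesis by (simp add: sample_law_def)
qed

text \<open>The estimate t is at distance at least half of |N1 - N0| from N1 or from N0. In the
  first case the first term suffices. In the second, \<open>p\<close> is exchanged for
  \<open>p0\<close> by the inequality of arithmetic and geometric means, at the price of a term in
  \<open>p\<^sup>2 / p0\<close> whose weight 1/E compensates a second moment of size E.\<close>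

lemma two_point_pointwise:
  fixes p p0 t N0 N1 E :: real
  assumes "0 \<le> p" "0 \<le> p0" "p0 = 0 \<Longrightarrow> p = 0" "0 < E"
  shows "(N1 - N0)\<^sup>2 / 4 * p
    \<le> p * (t - N1)\<^sup>2 + E * (p0 * (t - N0)\<^sup>2) + (N1 - N0)\<^sup>2 / (16 * E) * (p\<^sup>2 / p0)"
proof (cases "(t - N1)\<^sup>2 \<ge> (N1 - N0)\<^sup>2 / 4")
  case True
  then have "(N1 - N0)\<^sup>2 / 4 * p \<le> p * (t - N1)\<^sup>2"
    using assms(1) by (subst mult.commute) (rule mult_left_mono)
  moreover have "0 \<le> E * (p0 * (t - N0)\<^sup>2)" "0 \<le> (N1 - N0)\<^sup>2 / (16 * E) * (p\<^sup>2 / p0)"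
    using assms by simp_all
  ultimately show ?thesis by linarith
next
  case False
  have "(N1 - N0)\<^sup>2 \<le> 2 * (t - N1)\<^sup>2 + 2 * (t - N0)\<^sup>2"
  proof -
    have "2 * (t - N1)\<^sup>2 + 2 * (t - N0)\<^sup>2 - (N1 - N0)\<^sup>2 = ((t - N1) + (t - N0))\<^sup>2"
      by (simp add: power2_eq_square algebra_simps)
    then show ?thesis using zero_le_power2[of "(t - N1) + (t - N0)"] by linarith
  qed
  then have a: "(N1 - N0)\<^sup>2 / 4 \<le> (t - N0)\<^sup>2" using False by linarith
  \<comment> \<open>This is (2 E p0 - p)^2 \<ge> 0 divided by 4 E p0; for \<open>p0 = 0\<close> the
    quotient is 0 by convention and \<open>p = 0\<close> by hypothesis.\<close>
  have amgm: "p \<le> E * p0 + p\<^sup>2 / (4 * E * p0)"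
  proof (cases "p0 = 0")
    case False
    then have "0 < p0" using assms by simp
    then have "E * p0 + p\<^sup>2 / (4 * E * p0) - p = (2 * E * p0 - p)\<^sup>2 / (4 * E * p0)"
      using \<open>0 < E\<close> by (simp add: field_simps power2_eq_square)
    moreover have "0 \<le> (2 * E * p0 - p)\<^sup>2 / (4 * E * p0)" using \<open>0 < p0\<close> \<open>0 < E\<close> by simp
    ultimately show ?thesis by linarith
  qed (use assms in simp)
  have "(N1 - N0)\<^sup>2 / 4 * p \<le> (N1 - N0)\<^sup>2 / 4 * (E * p0 + p\<^sup>2 / (4 * E * p0))"
    by (rule mult_left_mono[OF amgm]) simp
  also have "\<dots> = (N1 - N0)\<^sup>2 / 4 * (E * p0) + (N1 - N0)\<^sup>2 / (16 * E) * (p\<^sup>2 / p0)"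
    by (simp add: algebra_simps)
  also have "(N1 - N0)\<^sup>2 / 4 * (E * p0) \<le> (t - N0)\<^sup>2 * (E * p0)"
    by (rule mult_right_mono[OF a]) (use assms in simp)
  finally have "(N1 - N0)\<^sup>2 / 4 * p
      \<le> (t - N0)\<^sup>2 * (E * p0) + (N1 - N0)\<^sup>2 / (16 * E) * (p\<^sup>2 / p0)" by simp
  moreover have "0 \<le> p * (t - N1)\<^sup>2" using assms by simp
  ultimately show ?thesis by (simp add: mult_ac)
qed

text \<open>
  The bound on \<open>E\<close> is the second moment of the likelihood ratio of the mixture against \<open>f0\<close>, which
  factorises over the sample.
\<close>

lemma mixture_lower_bound:
  fixes f0 :: "real^'d::finite \<Rightarrow> real" and q :: "'w \<Rightarrow> real^'d \<Rightarrow> real"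
  assumes \<Omega>: "finite \<Omega>" "\<Omega> \<noteq> {}"
    and f0: "f0 \<in> borel_measurable borel" "\<And>x. 0 \<le> f0 x" "(\<integral>\<^sup>+x. ennreal (f0 x) \<partial>lborel) = 1"
    and q: "\<And>w. q w \<in> borel_measurable borel" "\<And>w x. w \<in> \<Omega> \<Longrightarrow> 0 \<le> q w x"
      "\<And>w. w \<in> \<Omega> \<Longrightarrow> (\<integral>\<^sup>+x. ennreal (q w x) \<partial>lborel) = 1"
    and ac: "\<And>w x. w \<in> \<Omega> \<Longrightarrow> f0 x = 0 \<Longrightarrow> q w x = 0"
    and E: "0 < E" "(\<Sum>w\<in>\<Omega>. \<Sum>w'\<in>\<Omega>. (\<integral>\<^sup>+x. ennreal (q w x * q w' x / f0 x) \<partial>lborel) ^ n)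
        \<le> ennreal (E * (real (card \<Omega>))\<^sup>2)"
    and T: "T \<in> estimators n"
    and B: "\<And>w. w \<in> \<Omega> \<Longrightarrow> (\<integral>\<^sup>+X. ennreal ((T X - N1)\<^sup>2) \<partial>sample_law n (q w)) \<le> B"
  shows "ennreal (3 / 16 * (N1 - N0)\<^sup>2)
    \<le> ennreal E * (\<integral>\<^sup>+X. ennreal ((T X - N0)\<^sup>2) \<partial>sample_law n f0) + B"
proof -
  define P where "P = (\<Pi>\<^sub>M i\<in>{..<n}. (lborel :: (real^'d) measure))"
  interpret L: product_sigma_finite "\<lambda>_::nat. (lborel :: (real^'d) measure)" by standard
  define c where "c = real (card \<Omega>)"
  have c: "0 < c" using \<Omega> by (simp add: c_def card_gt_0_iff)
  define p0 where "p0 X = (\<Prod>i<n. f0 (X i))" for X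
  define p where "p w X = (\<Prod>i<n. q w (X i))" for w X
  define pb where "pb X = (\<Sum>w\<in>\<Omega>. p w X) / c" for X
  note [measurable] = f0(1) q(1)
  have comp [measurable]: "(\<lambda>X. X i) \<in> P \<rightarrow>\<^sub>M borel" if "i \<in> {..<n}" for i
    using measurable_component_singleton[OF that, of "\<lambda>_. lborel"] by (simp add: P_def)
  have prod_meas: "(\<lambda>X. \<Prod>i<n. g (X i)) \<in> borel_measurable P"
    if "g \<in> borel_measurable borel" for g :: "real^'d \<Rightarrow> real"
    by (intro borel_measurable_prod measurable_compose[OF comp that])
  have m0 [measurable]: "p0 \<in> borel_measurable P" unfolding p0_def by (rule prod_meas) (rule f0)
  have mp [measurable]: "p w \<in> borel_measurable P" for w unfolding p_def by (rule prod_meas) (rule q)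
  have mpb [measurable]: "pb \<in> borel_measurable P" unfolding pb_def by measurable
  have mT [measurable]: "T \<in> borel_measurable P"
  proof -
    have "sets P = sets (\<Pi>\<^sub>M i\<in>{..<n}. borel)" unfolding P_def by (rule sets_PiM_cong) auto
    then show ?thesis using T unfolding estimators_def by (simp cong: measurable_cong_sets)
  qed
  have p0_nn: "0 \<le> p0 X" for X by (simp add: p0_def prod_nonneg f0)
  have p_nn: "0 \<le> p w X" if "w \<in> \<Omega>" for w X using that by (simp add: p_def prod_nonneg q)
  have pb_nn: "0 \<le> pb X" for X using c by (simp add: pb_def sum_nonneg p_nn)
  have prod_ennreal: "(\<Prod>i<n. ennreal (g (X i))) = ennreal (\<Prod>i<n. g (X i))"
    if "\<And>x. 0 \<le> g x" for g and X :: "nat \<Rightarrow> real^'d" using that by (simp add: prod_ennreal)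
  have law: "(\<integral>\<^sup>+X. ennreal (h X) \<partial>sample_law n g)
      = (\<integral>\<^sup>+X. ennreal ((\<Prod>i<n. g (X i)) * h X) \<partial>P)"
    if g: "g \<in> borel_measurable borel" "\<And>x. 0 \<le> g x"
      "(\<integral>\<^sup>+x. ennreal (g x) \<partial>lborel) = 1" and h: "h \<in> borel_measurable P" for g h
  proof -
    have "sample_law n g = density P (\<lambda>X. ennreal (\<Prod>i<n. g (X i)))"
      using sample_law_eq_density[OF g(1,3), of n] prod_ennreal[of g] g(2) by (simp add: P_def)
    moreover have "(\<integral>\<^sup>+X. ennreal (h X) \<partial>density P (\<lambda>X. ennreal (\<Prod>i<n. g (X i))))
        = (\<integral>\<^sup>+X. ennreal (\<Prod>i<n. g (X i)) * ennreal (h X) \<partial>P)"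
      using h prod_meas[OF g(1)] by (intro nn_integral_density) auto
    ultimately show ?thesis by (simp add: ennreal_mult' prod_nonneg g(2))
  qed
  have int_p: "(\<integral>\<^sup>+X. ennreal (p w X) \<partial>P) = 1" if "w \<in> \<Omega>" for w
  proof -
    have "(\<integral>\<^sup>+X. ennreal (p w X) \<partial>P) = (\<integral>\<^sup>+X. (\<Prod>i<n. ennreal (q w (X i))) \<partial>P)"
      unfolding p_def by (simp add: prod_ennreal q that)
    also have "\<dots> = (\<Prod>i<n. \<integral>\<^sup>+x. ennreal (q w x) \<partial>lborel)"
      unfolding P_def by (rule L.product_nn_integral_prod) auto
    finally show ?thesis by (simp add: q that)
  qed
  have avg: "(\<integral>\<^sup>+X. ennreal (pb X * h X) \<partial>P) = ennreal (1 / c) * (\<Sum>w\<in>\<Omega>. \<integral>\<^sup>+X. ennreal (p w X * h X) \<partial>P)"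
    if [measurable]: "h \<in> borel_measurable P" and "\<And>X. 0 \<le> h X" for h
  proof -
    have "(\<integral>\<^sup>+X. ennreal (pb X * h X) \<partial>P) = (\<integral>\<^sup>+X. ennreal (1 / c) * (\<Sum>w\<in>\<Omega>. ennreal (p w X * h X)) \<partial>P)"
    proof (rule nn_integral_cong)
      fix X
      have "pb X * h X = 1 / c * (\<Sum>w\<in>\<Omega>. p w X * h X)"
        by (simp add: pb_def sum_distrib_right)
      then have "ennreal (pb X * h X) = ennreal (1 / c) * ennreal (\<Sum>w\<in>\<Omega>. p w X * h X)"
        using c by (simp only: ennreal_mult' zero_le_divide_1_iff less_imp_le)
      also have "ennreal (\<Sum>w\<in>\<Omega>. p w X * h X) = (\<Sum>w\<in>\<Omega>. ennreal (p w X * h X))"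
        by (rule sum_ennreal[symmetric]) (intro mult_nonneg_nonneg p_nn that)
      finally show "ennreal (pb X * h X) = ennreal (1 / c) * (\<Sum>w\<in>\<Omega>. ennreal (p w X * h X))" .
    qed
    also have "\<dots> = ennreal (1 / c) * (\<integral>\<^sup>+X. (\<Sum>w\<in>\<Omega>. ennreal (p w X * h X)) \<partial>P)"
      by (rule nn_integral_cmult) measurable
    also have "(\<integral>\<^sup>+X. (\<Sum>w\<in>\<Omega>. ennreal (p w X * h X)) \<partial>P) = (\<Sum>w\<in>\<Omega>. \<integral>\<^sup>+X. ennreal (p w X * h X) \<partial>P)"
      by (rule nn_integral_sum) measurable
    finally show ?thesis .
  qed
  have card_c: "ennreal (1 / c) * (of_nat (card \<Omega>) * y) = y" for y
  proof -
    have "ennreal (1 / c) * of_nat (card \<Omega>) = 1"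
      using c by (simp add: c_def ennreal_of_nat_eq_real_of_nat flip: ennreal_mult')
    then show ?thesis by (simp flip: mult.assoc)
  qed
  have int_pb: "(\<integral>\<^sup>+X. ennreal (pb X) \<partial>P) = 1"
    using avg[of "\<lambda>_. 1"] card_c[of 1] by (simp add: int_p)
  have int_pb_B: "(\<integral>\<^sup>+X. ennreal (pb X * (T X - N1)\<^sup>2) \<partial>P) \<le> B"
  proof -
    have "(\<integral>\<^sup>+X. ennreal (p w X * (T X - N1)\<^sup>2) \<partial>P) \<le> B" if "w \<in> \<Omega>" for w
      using law[of "q w" "\<lambda>X. (T X - N1)\<^sup>2"] B[OF that] q that by (simp add: p_def)
    then have "(\<Sum>w\<in>\<Omega>. \<integral>\<^sup>+X. ennreal (p w X * (T X - N1)\<^sup>2) \<partial>P) \<le> of_nat (card \<Omega>) * B"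
      by (rule sum_bounded_above)
    then have "ennreal (1 / c) * (\<Sum>w\<in>\<Omega>. \<integral>\<^sup>+X. ennreal (p w X * (T X - N1)\<^sup>2) \<partial>P)
        \<le> ennreal (1 / c) * (of_nat (card \<Omega>) * B)"
      by (rule mult_left_mono) simp
    then show ?thesis unfolding card_c by (subst avg) auto
  qed
  have chi2: "(\<integral>\<^sup>+X. ennreal ((pb X)\<^sup>2 / p0 X) \<partial>P) \<le> ennreal E"
  proof -
    let ?g = "\<lambda>w w' x. q w x * q w' x / f0 x"
    have gnn: "0 \<le> ?g w w' x" if "w \<in> \<Omega>" "w' \<in> \<Omega>" for w w' x using that f0 q by simp
    have "(\<integral>\<^sup>+X. ennreal ((pb X)\<^sup>2 / p0 X) \<partial>P)
        = (\<integral>\<^sup>+X. ennreal (1 / c\<^sup>2) * (\<Sum>w\<in>\<Omega>. \<Sum>w'\<in>\<Omega>. \<Prod>i<n. ennreal (?g w w' (X i))) \<partial>P)"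
    proof (rule nn_integral_cong)
      fix X
      have "(pb X)\<^sup>2 / p0 X = 1 / c\<^sup>2 * (\<Sum>w\<in>\<Omega>. \<Sum>w'\<in>\<Omega>. p w X * p w' X / p0 X)"
        by (simp add: pb_def power2_eq_square sum_product sum_divide_distrib mult_ac)
      also have "\<dots> = 1 / c\<^sup>2 * (\<Sum>w\<in>\<Omega>. \<Sum>w'\<in>\<Omega>. \<Prod>i<n. ?g w w' (X i))"
        by (simp add: p_def p0_def prod.distrib prod_dividef)
      finally have "ennreal ((pb X)\<^sup>2 / p0 X)
          = ennreal (1 / c\<^sup>2) * ennreal (\<Sum>w\<in>\<Omega>. \<Sum>w'\<in>\<Omega>. \<Prod>i<n. ?g w w' (X i))"
        by (simp only: ennreal_mult'[of "1 / c\<^sup>2"] zero_le_divide_1_iff zero_le_power2)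
      also have "ennreal (\<Sum>w\<in>\<Omega>. \<Sum>w'\<in>\<Omega>. \<Prod>i<n. ?g w w' (X i))
          = (\<Sum>w\<in>\<Omega>. \<Sum>w'\<in>\<Omega>. \<Prod>i<n. ennreal (?g w w' (X i)))"
      proof -
        have "ennreal (\<Sum>w\<in>\<Omega>. \<Sum>w'\<in>\<Omega>. \<Prod>i<n. ?g w w' (X i))
            = (\<Sum>w\<in>\<Omega>. ennreal (\<Sum>w'\<in>\<Omega>. \<Prod>i<n. ?g w w' (X i)))"
          by (rule sum_ennreal[symmetric]) (intro sum_nonneg prod_nonneg gnn)
        also have "\<dots> = (\<Sum>w\<in>\<Omega>. \<Sum>w'\<in>\<Omega>. ennreal (\<Prod>i<n. ?g w w' (X i)))"
          by (intro sum.cong refl sum_ennreal[symmetric] prod_nonneg gnn)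
        also have "\<dots> = (\<Sum>w\<in>\<Omega>. \<Sum>w'\<in>\<Omega>. \<Prod>i<n. ennreal (?g w w' (X i)))"
          by (intro sum.cong refl prod_ennreal[symmetric] gnn)
        finally show ?thesis .
      qed
      finally show "ennreal ((pb X)\<^sup>2 / p0 X)
          = ennreal (1 / c\<^sup>2) * (\<Sum>w\<in>\<Omega>. \<Sum>w'\<in>\<Omega>. \<Prod>i<n. ennreal (?g w w' (X i)))" .
    qed
    also have "\<dots> = ennreal (1 / c\<^sup>2)
        * (\<integral>\<^sup>+X. (\<Sum>w\<in>\<Omega>. \<Sum>w'\<in>\<Omega>. \<Prod>i<n. ennreal (?g w w' (X i))) \<partial>P)"
      by (rule nn_integral_cmult) measurable
    also have "(\<integral>\<^sup>+X. (\<Sum>w\<in>\<Omega>. \<Sum>w'\<in>\<Omega>. \<Prod>i<n. ennreal (?g w w' (X i))) \<partial>P)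
        = (\<Sum>w\<in>\<Omega>. \<Sum>w'\<in>\<Omega>. \<integral>\<^sup>+X. (\<Prod>i<n. ennreal (?g w w' (X i))) \<partial>P)"
      by (subst nn_integral_sum, measurable, intro sum.cong refl nn_integral_sum) measurable
    also have "\<dots> = (\<Sum>w\<in>\<Omega>. \<Sum>w'\<in>\<Omega>. (\<integral>\<^sup>+x. ennreal (?g w w' x) \<partial>lborel) ^ n)"
      unfolding P_def by (intro sum.cong refl, subst L.product_nn_integral_prod) auto
    also have "ennreal (1 / c\<^sup>2) * \<dots> \<le> ennreal (1 / c\<^sup>2) * ennreal (E * c\<^sup>2)"
      using E(2) by (intro mult_left_mono) (auto simp: c_def)
    also have "\<dots> = ennreal E"
      using c by (simp flip: ennreal_mult')
    finally show ?thesis .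
  qed
  have sup0: "pb X = 0" if zero: "p0 X = 0" for X
  proof -
    obtain i where "i < n" "f0 (X i) = 0" using zero by (auto simp: p0_def)
    then have "p w X = 0" if "w \<in> \<Omega>" for w using ac[OF that] by (auto simp: p_def)
    then show ?thesis by (simp add: pb_def)
  qed
  let ?D = "(N1 - N0)\<^sup>2"
  have "ennreal (?D / 4) = (\<integral>\<^sup>+X. ennreal (?D / 4) * ennreal (pb X) \<partial>P)"
    using nn_integral_cmult[of "\<lambda>X. ennreal (pb X)" P "ennreal (?D / 4)"] int_pb by simp
  also have "\<dots> \<le> (\<integral>\<^sup>+X. ennreal (pb X * (T X - N1)\<^sup>2)
      + (ennreal E * ennreal (p0 X * (T X - N0)\<^sup>2)
      + ennreal (?D / (16 * E)) * ennreal ((pb X)\<^sup>2 / p0 X)) \<partial>P)"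
  proof (rule nn_integral_mono)
    fix X
    have "ennreal (?D / 4) * ennreal (pb X) = ennreal (?D / 4 * pb X)"
      by (rule ennreal_mult'[symmetric]) simp
    also have "\<dots> \<le> ennreal (pb X * (T X - N1)\<^sup>2 + (E * (p0 X * (T X - N0)\<^sup>2)
        + ?D / (16 * E) * ((pb X)\<^sup>2 / p0 X)))"
      using two_point_pointwise[OF pb_nn p0_nn sup0 E(1), of X X N1 N0 "T X"]
      by (intro ennreal_leI) (simp add: add.assoc)
    also have "\<dots> = ennreal (pb X * (T X - N1)\<^sup>2)
        + (ennreal (E * (p0 X * (T X - N0)\<^sup>2)) + ennreal (?D / (16 * E) * ((pb X)\<^sup>2 / p0 X)))"
      using pb_nn p0_nn E(1) by (subst ennreal_plus; simp)+
    also have "\<dots> = ennreal (pb X * (T X - N1)\<^sup>2)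
      + (ennreal E * ennreal (p0 X * (T X - N0)\<^sup>2)
      + ennreal (?D / (16 * E)) * ennreal ((pb X)\<^sup>2 / p0 X))"
    proof -
      have "ennreal (E * y) = ennreal E * ennreal y" for y
        using E(1) by (intro ennreal_mult') simp
      moreover have "ennreal (?D / (16 * E) * y) = ennreal (?D / (16 * E)) * ennreal y" for y
        using E(1) by (intro ennreal_mult') simp
      ultimately show ?thesis by (simp only:)
    qed
    finally show "ennreal (?D / 4) * ennreal (pb X) \<le> \<dots>" .
  qed
  also have "\<dots> = (\<integral>\<^sup>+X. ennreal (pb X * (T X - N1)\<^sup>2) \<partial>P)
      + (ennreal E * (\<integral>\<^sup>+X. ennreal (p0 X * (T X - N0)\<^sup>2) \<partial>P)
      + ennreal (?D / (16 * E)) * (\<integral>\<^sup>+X. ennreal ((pb X)\<^sup>2 / p0 X) \<partial>P))"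
    by (simp add: nn_integral_add nn_integral_cmult)
  also have "\<dots> \<le> B + (ennreal E * (\<integral>\<^sup>+X. ennreal (p0 X * (T X - N0)\<^sup>2) \<partial>P)
      + ennreal (?D / (16 * E)) * ennreal E)"
    by (intro add_mono int_pb_B order_refl mult_left_mono chi2) simp
  also have "(\<integral>\<^sup>+X. ennreal (p0 X * (T X - N0)\<^sup>2) \<partial>P)
      = (\<integral>\<^sup>+X. ennreal ((T X - N0)\<^sup>2) \<partial>sample_law n f0)"
    using law[of f0 "\<lambda>X. (T X - N0)\<^sup>2"] f0 by (simp add: p0_def)
  \<comment> \<open>The weight 1/(16 E) cancels the second moment, so this term is a fixed fraction
    of \<open>?D\<close> however large E is.\<close>
  also have "ennreal (?D / (16 * E)) * ennreal E = ennreal (?D / 16)"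
    using E(1) by (simp flip: ennreal_mult')
  finally have main: "ennreal (?D / 4) \<le> (ennreal E
      * (\<integral>\<^sup>+X. ennreal ((T X - N0)\<^sup>2) \<partial>sample_law n f0) + B) + ennreal (?D / 16)"
    by (simp add: add_ac)
  \<comment> \<open>What remains is 1/4 - 1/16 = 3/16. The case split makes the subtraction
    legitimate in \<open>ennreal\<close>; an infinite y is trivial.\<close>
  have cancel: "ennreal (3 / 16 * ?D) \<le> y" if "ennreal (?D / 4) \<le> y + ennreal (?D / 16)" for y
  proof (cases y rule: ennreal_cases)
    case (real r)
    then have "?D / 4 \<le> r + ?D / 16"
      using that by (simp flip: ennreal_plus)
    then show ?thesis using real by (simp add: ennreal_leI)
  qed simp
  show ?thesis by (rule cancel[OF main])
qed

subsection \<open>Random signs on disjoint bumps\<close>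

text \<open>Averaging \<open>exp (g * s)\<close> over a random sign s gives \<open>cosh g\<close>;
  this turns the average into a Gaussian-type bound. The sharp exponent is half as large, which
  would affect constants only.\<close>

lemma cosh_le_exp_square: "cosh x \<le> exp (x\<^sup>2)" for x :: real
proof -
  have "cosh y \<le> exp (y\<^sup>2)" if "0 \<le> y" for y :: real
  proof (cases "y \<le> 1")
    case True
    have "exp y \<le> 1 + y + y\<^sup>2" using exp_bound[OF that True] .
    moreover have "exp (- y) \<le> 1 - y + y\<^sup>2"
    proof -
      have "exp (- y) \<le> 1 / (1 + y)"
        using le_imp_inverse_le[OF exp_ge_add_one_self[of y]] that
        by (simp add: exp_minus inverse_eq_divide)
      also have "\<dots> \<le> 1 - y + y\<^sup>2"
      proof -
        have "1 \<le> 1 + y * y\<^sup>2" using that by simp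
        also have "\<dots> = (1 - y + y\<^sup>2) * (1 + y)"
          by (simp add: power2_eq_square algebra_simps)
        finally show ?thesis using that by (simp add: divide_simps)
      qed
      finally show ?thesis .
    qed
    ultimately have "cosh y \<le> 1 + y\<^sup>2" by (simp add: cosh_field_def)
    also have "\<dots> \<le> exp (y\<^sup>2)" by (rule exp_ge_add_one_self)
    finally show ?thesis .
  next
    case False
    have "cosh y \<le> exp y" using that by (simp add: cosh_field_def)
    also have "\<dots> \<le> exp (y\<^sup>2)" using False by (simp add: power2_eq_square)
    finally show ?thesis .
  qed
  from this[of "\<bar>x\<bar>"] show ?thesis by simp
qed

lemma ennpow_half_square: "(ennpow x (1 / 2))\<^sup>2 = x"
proof (cases x rule: ennreal_cases)
  case (real r)
  then have "(ennpow x (1 / 2))\<^sup>2 = ennreal ((r powr (1 / 2))\<^sup>2)"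
    by (simp add: ennpow_ennreal ennreal_power)
  then show ?thesis using real by (simp add: powr_half_sqrt)
qed (simp add: ennpow_def)

lemma square_risk_ge:
  assumes "f \<in> F \<inter> L2_densities" "Lp_norm 2 f = ennreal N" "0 \<le> N"
  shows "(\<integral>\<^sup>+X. ennreal ((T X - N)\<^sup>2) \<partial>sample_law n f) \<le> (risk n T F)\<^sup>2"
proof -
  have "ennpow (\<integral>\<^sup>+X. ennreal ((T X - N)\<^sup>2) \<partial>sample_law n f) (1 / 2) \<le> risk n T F"
    unfolding risk_def using assms by (intro SUP_upper2[OF assms(1)]) simp
  then have "(ennpow (\<integral>\<^sup>+X. ennreal ((T X - N)\<^sup>2) \<partial>sample_law n f) (1 / 2))\<^sup>2 \<le> (risk n T F)\<^sup>2"
    by (rule power_mono) simp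
  then show ?thesis by (simp only: ennpow_half_square)
qed

lemma nn_integral_eq_1:
  assumes "has_bochner_integral lborel f 1" "\<And>x. 0 \<le> f x"
  shows "(\<integral>\<^sup>+x. ennreal (f x) \<partial>lborel) = 1"
  using assms nn_integral_eq_integral[of lborel f] by (simp add: has_bochner_integral_iff)

text \<open>\<open>f0\<close> takes its upper bound A wherever a bump lives. Hence adding or
  subtracting A times a bump stays within [0, 2 A], and dividing by \<open>f0\<close> on a bump is
  dividing by a constant.\<close>

locale perturbed_density =
  fixes f0 :: "real^'d::finite \<Rightarrow> real" and A :: real and I :: "'i set"
    and \<Lambda> :: "'i \<Rightarrow> real^'d \<Rightarrow> real"
  assumes finite_I: "finite I"
    and A_pos: "0 < A"
    and f0_nonneg: "0 \<le> f0 x" and f0_le: "f0 x \<le> A"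
    and f0_integral: "has_bochner_integral lborel f0 1"
    and \<Lambda>_bound: "\<bar>\<Lambda> m x\<bar> \<le> 1"
    and \<Lambda>_integral: "has_bochner_integral lborel (\<Lambda> m) 0"
    and \<Lambda>_disjoint: "m \<in> I \<Longrightarrow> m' \<in> I \<Longrightarrow> \<Lambda> m x \<noteq> 0 \<Longrightarrow> \<Lambda> m' x \<noteq> 0 \<Longrightarrow> m = m'"
    and f0_plateau: "m \<in> I \<Longrightarrow> \<Lambda> m x \<noteq> 0 \<Longrightarrow> f0 x = A"
begin

definition signs :: "('i \<Rightarrow> real) set" where
  "signs = PiE I (\<lambda>_. {-1, 1})"

definition perturbed :: "('i \<Rightarrow> real) \<Rightarrow> real^'d \<Rightarrow> real" where
  "perturbed w x = f0 x + A * (\<Sum>m\<in>I. w m * \<Lambda> m x)"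

definition energy :: "'i \<Rightarrow> real" where
  "energy m = (LINT x|lborel. (\<Lambda> m x)\<^sup>2)"

lemma measurable_f0 [measurable]: "f0 \<in> borel_measurable borel"
  using borel_measurable_has_bochner_integral[OF f0_integral] by simp

lemma measurable_\<Lambda> [measurable]: "\<Lambda> m \<in> borel_measurable borel"
  using borel_measurable_has_bochner_integral[OF \<Lambda>_integral] by simp

lemma measurable_perturbed [measurable]: "perturbed w \<in> borel_measurable borel"
  unfolding perturbed_def[abs_def] by measurable

lemma finite_signs: "finite signs"
  unfolding signs_def using finite_I by (intro finite_PiE) auto

lemma card_signs: "card signs = 2 ^ card I"
  unfolding signs_def using finite_I by (simp add: card_PiE numeral_2_eq_2)

lemma signs_nonempty: "signs \<noteq> {}"
  using card_signs by auto

lemma signs_square: "w \<in> signs \<Longrightarrow> m \<in> I \<Longrightarrow> (w m)\<^sup>2 = 1"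
  by (auto simp: signs_def PiE_def Pi_def)

text \<open>Disjointness collapses every sum over bumps to at most one term at a given point, so the
  pointwise identities below become polynomial identities in a single bump value.\<close>

lemma at_most_one_bump:
  obtains (none) "\<And>m. m \<in> I \<Longrightarrow> \<Lambda> m x = 0"
    | (one) m where "m \<in> I" "f0 x = A" "\<And>c. (\<Sum>m\<in>I. c m * \<Lambda> m x) = c m * \<Lambda> m x"
        "\<And>c. (\<Sum>m\<in>I. c m * (\<Lambda> m x)\<^sup>2) = c m * (\<Lambda> m x)\<^sup>2"
proof (cases "\<exists>m\<in>I. \<Lambda> m x \<noteq> 0")
  case True
  then obtain m where m: "m \<in> I" "\<Lambda> m x \<noteq> 0" by blast
  then have other: "\<Lambda> m' x = 0" if "m' \<in> I - {m}" for m' using that \<Lambda>_disjoint by blast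
  have "(\<Sum>m\<in>I. c m * \<Lambda> m x) = c m * \<Lambda> m x" "(\<Sum>m\<in>I. c m * (\<Lambda> m x)\<^sup>2) = c m * (\<Lambda> m x)\<^sup>2" for c
    using other by (simp_all add: sum.remove[OF finite_I m(1)])
  then show ?thesis using one[of m] m f0_plateau by blast
next
  case False
  then show ?thesis using none by blast
qed

lemma perturbed_range:
  assumes "w \<in> signs"
  shows "0 \<le> perturbed w x" "perturbed w x \<le> 2 * A"
proof -
  have "0 \<le> perturbed w x \<and> perturbed w x \<le> 2 * A"
  proof (cases rule: at_most_one_bump[of x])
    case none
    then show ?thesis using f0_nonneg[of x] f0_le[of x] A_pos by (simp add: perturbed_def)
  next
    case (one m)
    have "w m = 1 \<or> w m = -1" using assms one(1) by (auto simp: signs_def PiE_def Pi_def)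
    then have "\<bar>w m * \<Lambda> m x\<bar> \<le> 1" using \<Lambda>_bound[of m x] by auto
    then have "\<bar>A * (w m * \<Lambda> m x)\<bar> \<le> A * 1"
      using A_pos by (simp only: abs_mult[of A]) (intro mult_mono; simp)
    then show ?thesis unfolding perturbed_def one(2,3) by (simp add: abs_le_iff)
  qed
  then show "0 \<le> perturbed w x" "perturbed w x \<le> 2 * A" by auto
qed

lemma perturbed_eq_0:
  assumes "f0 x = 0" shows "perturbed w x = 0"
  using assms A_pos by (cases rule: at_most_one_bump[of x]) (auto simp: perturbed_def)

lemma \<Lambda>_square_integral: "has_bochner_integral lborel (\<lambda>x. (\<Lambda> m x)\<^sup>2) (energy m)"
proof -
  have "integrable lborel (\<lambda>x. (\<Lambda> m x)\<^sup>2)"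
  proof (rule Bochner_Integration.integrable_bound)
    show "integrable lborel (\<Lambda> m)" using \<Lambda>_integral by (simp add: has_bochner_integral_iff)
    have "(\<Lambda> m x)\<^sup>2 \<le> \<bar>\<Lambda> m x\<bar>" for x
      using mult_left_le[OF \<Lambda>_bound[of m x], of "\<bar>\<Lambda> m x\<bar>"]
      by (simp add: power2_eq_square flip: abs_mult)
    then show "AE x in lborel. norm ((\<Lambda> m x)\<^sup>2) \<le> norm (\<Lambda> m x)" by simp
  qed measurable
  then show ?thesis by (simp add: has_bochner_integral_iff energy_def)
qed

lemma energy_nonneg: "0 \<le> energy m"
  unfolding energy_def by (rule Bochner_Integration.integral_nonneg) simp

text \<open>The perturbed densities, their squares and the likelihood products all have this shape.
  The linear terms drop out because the bumps have mean zero.\<close>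

lemma bump_sum_integral:
  "has_bochner_integral lborel (\<lambda>x. f x + (\<Sum>m\<in>I. b m * \<Lambda> m x) + (\<Sum>m\<in>I. c m * (\<Lambda> m x)\<^sup>2))
    (a + (\<Sum>m\<in>I. c m * energy m))"
  if "has_bochner_integral lborel f a"
proof -
  have "has_bochner_integral lborel
      (\<lambda>x. f x + (\<Sum>m\<in>I. b m * \<Lambda> m x) + (\<Sum>m\<in>I. c m * (\<Lambda> m x)\<^sup>2))
      (a + (\<Sum>m\<in>I. b m * 0) + (\<Sum>m\<in>I. c m * energy m))"
    by (intro has_bochner_integral_add has_bochner_integral_sum has_bochner_integral_mult_right
        that \<Lambda>_integral \<Lambda>_square_integral)
  then show ?thesis by simp
qed

lemma perturbed_integral: "has_bochner_integral lborel (perturbed w) 1"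
  using bump_sum_integral[OF f0_integral, of "\<lambda>m. A * w m" "\<lambda>_. 0"]
  by (simp add: perturbed_def[abs_def] sum_distrib_left mult_ac)

definition norm_sq :: real where
  "norm_sq = (LINT x|lborel. (f0 x)\<^sup>2)"

lemma f0_square_integral: "has_bochner_integral lborel (\<lambda>x. (f0 x)\<^sup>2) norm_sq"
  and norm_sq_le: "norm_sq \<le> A" and norm_sq_nonneg: "0 \<le> norm_sq"
proof -
  have le: "(f0 x)\<^sup>2 \<le> A * f0 x" for x
    using mult_right_mono[OF f0_le f0_nonneg] by (simp add: power2_eq_square)
  have int: "integrable lborel (\<lambda>x. A * f0 x)" "(LINT x|lborel. A * f0 x) = A"
    using f0_integral by (auto simp: has_bochner_integral_iff)
  have i2: "integrable lborel (\<lambda>x. (f0 x)\<^sup>2)"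
  proof (rule Bochner_Integration.integrable_bound[OF int(1)])
    show "AE x in lborel. norm ((f0 x)\<^sup>2) \<le> norm (A * f0 x)"
      using le A_pos f0_nonneg by (simp add: abs_mult)
  qed measurable
  then show "has_bochner_integral lborel (\<lambda>x. (f0 x)\<^sup>2) norm_sq"
    by (simp add: has_bochner_integral_iff norm_sq_def)
  have "norm_sq \<le> (LINT x|lborel. A * f0 x)"
    unfolding norm_sq_def by (rule Bochner_Integration.integral_mono[OF i2 int(1)]) (rule le)
  then show "norm_sq \<le> A" by (simp only: int(2))
  show "0 \<le> norm_sq" unfolding norm_sq_def by (rule Bochner_Integration.integral_nonneg) simp
qed

text \<open>The signs enter only as coefficients of mean-zero bumps and through
  \<open>(w m)\<^sup>2 = 1\<close>, so the integral does not depend on \<open>w\<close>. All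
  components of the mixture thus share one value of the functional, as the two-point inequality
  requires.\<close>

lemma perturbed_square_integral:
  assumes "w \<in> signs"
  shows "has_bochner_integral lborel (\<lambda>x. (perturbed w x)\<^sup>2) (norm_sq + A\<^sup>2 * (\<Sum>m\<in>I. energy m))"
proof -
  have "(perturbed w x)\<^sup>2
      = (f0 x)\<^sup>2 + (\<Sum>m\<in>I. (2 * A\<^sup>2 * w m) * \<Lambda> m x) + (\<Sum>m\<in>I. A\<^sup>2 * (\<Lambda> m x)\<^sup>2)" for x
  proof (cases rule: at_most_one_bump[of x])
    case none
    then show ?thesis by (simp add: perturbed_def)
  next
    case (one m)
    have "(A + A * (w m * \<Lambda> m x))\<^sup>2
        = A\<^sup>2 + 2 * A\<^sup>2 * w m * \<Lambda> m x + A\<^sup>2 * ((w m)\<^sup>2 * (\<Lambda> m x)\<^sup>2)"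
      by (simp add: power2_eq_square algebra_simps)
    then show ?thesis
      unfolding perturbed_def one(2,3) one(4)[of "\<lambda>_. A\<^sup>2"] signs_square[OF assms one(1)] by simp
  qed
  then show ?thesis
    using bump_sum_integral[OF f0_square_integral, of "\<lambda>m. 2 * A\<^sup>2 * w m" "\<lambda>_. A\<^sup>2"]
    by (simp add: sum_distrib_left)
qed

text \<open>Off the bumps the quotient is \<open>f0\<close>, on a bump it is a quadratic polynomial.
  The nonnegativity is recorded because \<open>1 + x \<le> exp x\<close> is later raised to the n-th
  power.\<close>

lemma perturbed_product_integral:
  assumes "w \<in> signs" "w' \<in> signs"
  shows "(\<integral>\<^sup>+x. ennreal (perturbed w x * perturbed w' x / f0 x) \<partial>lborel)
      = ennreal (1 + A * (\<Sum>m\<in>I. w m * w' m * energy m))"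
    and "0 \<le> 1 + A * (\<Sum>m\<in>I. w m * w' m * energy m)"
proof -
  let ?h = "\<lambda>x. perturbed w x * perturbed w' x / f0 x"
  have "?h x = f0 x + (\<Sum>m\<in>I. (A * (w m + w' m)) * \<Lambda> m x)
      + (\<Sum>m\<in>I. (A * (w m * w' m)) * (\<Lambda> m x)\<^sup>2)" for x
  proof (cases rule: at_most_one_bump[of x])
    case none
    then show ?thesis by (simp add: perturbed_def)
  next
    case (one m)
    have "(A + A * (w m * \<Lambda> m x)) * (A + A * (w' m * \<Lambda> m x)) / A
        = A + A * (w m + w' m) * \<Lambda> m x + A * (w m * w' m) * (\<Lambda> m x)\<^sup>2"
      using A_pos by (simp add: field_simps power2_eq_square)
    then show ?thesis
      unfolding perturbed_def one(2) one(3)[of w] one(3)[of w'] one(3)[of "\<lambda>m. A * (w m + w' m)"]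
        one(4)[of "\<lambda>m. A * (w m * w' m)"] .
  qed
  then have int: "has_bochner_integral lborel ?h (1 + A * (\<Sum>m\<in>I. w m * w' m * energy m))"
    using bump_sum_integral[OF f0_integral, of "\<lambda>m. A * (w m + w' m)" "\<lambda>m. A * (w m * w' m)"]
    by (simp add: sum_distrib_left mult_ac)
  have nn: "0 \<le> ?h x" for x using perturbed_range(1) assms f0_nonneg by simp
  show "(\<integral>\<^sup>+x. ennreal (?h x) \<partial>lborel) = ennreal (1 + A * (\<Sum>m\<in>I. w m * w' m * energy m))"
    using nn_integral_eq_integral[of lborel ?h] int nn by (simp add: has_bochner_integral_iff)
  show "0 \<le> 1 + A * (\<Sum>m\<in>I. w m * w' m * energy m)"
    using int Bochner_Integration.integral_nonneg[of lborel ?h] nn by (simp add: has_bochner_integral_iff)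
qed

text \<open>After \<open>1 + x \<le> exp x\<close> the exponent is linear in \<open>w'\<close>, so
  for fixed \<open>w\<close> the sum over \<open>w'\<close> factorises into hyperbolic cosines, one
  per bump. Since \<open>w m\<close> is a sign, the bound for each factor does not depend on
  \<open>w\<close>.\<close>

lemma likelihood_second_moment:
  "(\<Sum>w\<in>signs. \<Sum>w'\<in>signs. (\<integral>\<^sup>+x. ennreal (perturbed w x * perturbed w' x / f0 x) \<partial>lborel) ^ n)
    \<le> ennreal (exp (\<Sum>m\<in>I. (real n * A * energy m)\<^sup>2) * (real (card signs))\<^sup>2)"
proof -
  define g where "g m = real n * A * energy m" for m
  have inner: "(\<Sum>w'\<in>signs. \<Prod>m\<in>I. exp (g m * w m * w' m)) \<le> exp (\<Sum>m\<in>I. (g m)\<^sup>2) * 2 ^ card I"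
    if w: "w \<in> signs" for w
  proof -
    have "(\<Sum>w'\<in>signs. \<Prod>m\<in>I. exp (g m * w m * w' m))
        = (\<Prod>m\<in>I. \<Sum>s\<in>{-1, 1}. exp (g m * w m * s))"
      unfolding signs_def using finite_I by (subst prod_sum_PiE) auto
    also have "\<dots> = (\<Prod>m\<in>I. 2 * cosh (g m * w m))"
      by (rule prod.cong) (auto simp: cosh_field_def)
    also have "\<dots> \<le> (\<Prod>m\<in>I. 2 * exp ((g m)\<^sup>2))"
    proof (rule prod_mono, intro conjI)
      fix m assume "m \<in> I"
      show "0 \<le> 2 * cosh (g m * w m)" using cosh_real_nonneg[of "g m * w m"] by simp
      show "2 * cosh (g m * w m) \<le> 2 * exp ((g m)\<^sup>2)"
        using cosh_le_exp_square[of "g m * w m"] signs_square[OF w \<open>m \<in> I\<close>]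
        by (simp add: power_mult_distrib)
    qed
    also have "\<dots> = exp (\<Sum>m\<in>I. (g m)\<^sup>2) * 2 ^ card I"
      using finite_I by (simp add: prod.distrib exp_sum)
    finally show ?thesis .
  qed
  have term_le: "(1 + A * (\<Sum>m\<in>I. w m * w' m * energy m)) ^ n \<le> (\<Prod>m\<in>I. exp (g m * w m * w' m))"
    if "w \<in> signs" "w' \<in> signs" for w w'
  proof -
    have "(1 + A * (\<Sum>m\<in>I. w m * w' m * energy m)) ^ n
        \<le> exp (A * (\<Sum>m\<in>I. w m * w' m * energy m)) ^ n"
      using perturbed_product_integral(2)[OF that] exp_ge_add_one_self by (intro power_mono)
    also have "\<dots> = exp (\<Sum>m\<in>I. g m * w m * w' m)"
      by (simp add: g_def sum_distrib_left mult_ac flip: exp_of_nat_mult)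
    finally show ?thesis using finite_I by (simp add: exp_sum)
  qed
  have "(\<Sum>w\<in>signs. \<Sum>w'\<in>signs. (1 + A * (\<Sum>m\<in>I. w m * w' m * energy m)) ^ n)
      \<le> (\<Sum>w\<in>signs. \<Sum>w'\<in>signs. \<Prod>m\<in>I. exp (g m * w m * w' m))"
    by (intro sum_mono term_le)
  also have "\<dots> \<le> (\<Sum>w\<in>signs. exp (\<Sum>m\<in>I. (g m)\<^sup>2) * 2 ^ card I)"
    by (rule sum_mono) (rule inner)
  also have "\<dots> = exp (\<Sum>m\<in>I. (g m)\<^sup>2) * (real (card signs))\<^sup>2"
    by (simp add: card_signs power2_eq_square mult_ac)
  finally have real_le: "(\<Sum>w\<in>signs. \<Sum>w'\<in>signs. (1 + A * (\<Sum>m\<in>I. w m * w' m * energy m)) ^ n)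
      \<le> exp (\<Sum>m\<in>I. (g m)\<^sup>2) * (real (card signs))\<^sup>2" .
  have "(\<Sum>w\<in>signs. \<Sum>w'\<in>signs.
        (\<integral>\<^sup>+x. ennreal (perturbed w x * perturbed w' x / f0 x) \<partial>lborel) ^ n)
      = (\<Sum>w\<in>signs. \<Sum>w'\<in>signs. ennreal ((1 + A * (\<Sum>m\<in>I. w m * w' m * energy m)) ^ n))"
    by (intro sum.cong refl) (simp add: perturbed_product_integral ennreal_power)
  also have "\<dots> = (\<Sum>w\<in>signs. ennreal (\<Sum>w'\<in>signs. (1 + A * (\<Sum>m\<in>I. w m * w' m * energy m)) ^ n))"
    by (intro sum.cong refl sum_ennreal zero_le_power perturbed_product_integral(2))
  also have "\<dots> = ennreal (\<Sum>w\<in>signs. \<Sum>w'\<in>signs. (1 + A * (\<Sum>m\<in>I. w m * w' m * energy m)) ^ n)"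
    by (intro sum_ennreal sum_nonneg zero_le_power perturbed_product_integral(2))
  also have "\<dots> \<le> ennreal (exp (\<Sum>m\<in>I. (g m)\<^sup>2) * (real (card signs))\<^sup>2)"
    by (rule ennreal_leI[OF real_le])
  finally show ?thesis by (simp only: g_def)
qed

text \<open>The squared norms differ by G = A^2 times the total energy. Both norms are at most the
  square root of 2 A, as a density bounded by 2 A has squared norm at most 2 A. Hence (N1 - N0)^2
  \<ge> G^2/(8 A), and 3/128 is 3/16 times 1/8.\<close>

lemma risk_lower_bound:
  assumes T: "T \<in> estimators n"
    and f0: "f0 \<in> F0 \<inter> L2_densities"
    and F: "\<And>w. w \<in> signs \<Longrightarrow> perturbed w \<in> F \<inter> L2_densities"
  shows "ennreal (3 / 128 * (A ^ 3 * (\<Sum>m\<in>I. energy m)\<^sup>2))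
    \<le> ennreal (exp (\<Sum>m\<in>I. (real n * A * energy m)\<^sup>2)) * (risk n T F0)\<^sup>2 + (risk n T F)\<^sup>2"
proof -
  define N0 where "N0 = sqrt norm_sq"
  define G where "G = A\<^sup>2 * (\<Sum>m\<in>I. energy m)"
  define N1 where "N1 = sqrt (norm_sq + G)"
  let ?E = "exp (\<Sum>m\<in>I. (real n * A * energy m)\<^sup>2)"
  have G0: "0 \<le> G" unfolding G_def by (intro mult_nonneg_nonneg sum_nonneg energy_nonneg) simp
  have norm0: "Lp_norm 2 f0 = ennreal N0"
    using Lp_norm_2[of f0] f0_square_integral by (simp add: N0_def has_bochner_integral_iff)
  have norm1: "Lp_norm 2 (perturbed w) = ennreal N1" if "w \<in> signs" for w
    using Lp_norm_2[of "perturbed w"] perturbed_square_integral[OF that]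
    by (simp add: N1_def G_def has_bochner_integral_iff)
  have N: "0 \<le> N0" "N0 \<le> N1" "N0\<^sup>2 = norm_sq" "N1\<^sup>2 = norm_sq + G"
    using norm_sq_nonneg G0 by (auto simp: N0_def N1_def)
  obtain w where w: "w \<in> signs" using signs_nonempty by blast
  have "norm_sq + G \<le> 2 * A"
  proof -
    have "(LINT x|lborel. (perturbed w x)\<^sup>2) \<le> (LINT x|lborel. 2 * A * perturbed w x)"
    proof (rule Bochner_Integration.integral_mono)
      show "integrable lborel (\<lambda>x. (perturbed w x)\<^sup>2)"
        using perturbed_square_integral[OF w] by (simp add: has_bochner_integral_iff)
      show "integrable lborel (\<lambda>x. 2 * A * perturbed w x)"
        using perturbed_integral[of w] by (simp add: has_bochner_integral_iff)
      show "(perturbed w x)\<^sup>2 \<le> 2 * A * perturbed w x" for x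
        using mult_right_mono[OF perturbed_range(2)[OF w] perturbed_range(1)[OF w]]
        by (simp add: power2_eq_square)
    qed
    then show ?thesis
      using perturbed_square_integral[OF w] perturbed_integral[of w]
      by (simp add: has_bochner_integral_iff G_def)
  qed
  then have "(N1 + N0)\<^sup>2 \<le> 8 * A"
  proof -
    have "(N1 + N0)\<^sup>2 \<le> (2 * N1)\<^sup>2" using N by (intro power_mono) auto
    also have "\<dots> = 4 * N1\<^sup>2" by (simp add: power2_eq_square)
    also have "\<dots> \<le> 8 * A" using N(4) \<open>norm_sq + G \<le> 2 * A\<close> by simp
    finally show ?thesis .
  qed
  moreover have "((N1 - N0) * (N1 + N0))\<^sup>2 = G\<^sup>2"
  proof -
    have "(N1 - N0) * (N1 + N0) = N1\<^sup>2 - N0\<^sup>2" by (simp add: power2_eq_square algebra_simps)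
    then show ?thesis using N by simp
  qed
  ultimately have "G\<^sup>2 \<le> (N1 - N0)\<^sup>2 * (8 * A)"
    using mult_left_mono[of "(N1 + N0)\<^sup>2" "8 * A" "(N1 - N0)\<^sup>2"]
    by (simp add: power_mult_distrib)
  moreover have "G\<^sup>2 = A * (A ^ 3 * (\<Sum>m\<in>I. energy m)\<^sup>2)"
    unfolding G_def by (simp add: power_mult_distrib power2_eq_square power3_eq_cube)
  ultimately have "A * (A ^ 3 * (\<Sum>m\<in>I. energy m)\<^sup>2) \<le> A * (8 * (N1 - N0)\<^sup>2)"
    by (simp add: mult_ac)
  then have "A ^ 3 * (\<Sum>m\<in>I. energy m)\<^sup>2 \<le> 8 * (N1 - N0)\<^sup>2"
    using A_pos by (rule mult_left_le_imp_le)
  then have "ennreal (3 / 128 * (A ^ 3 * (\<Sum>m\<in>I. energy m)\<^sup>2)) \<le> ennreal (3 / 16 * (N1 - N0)\<^sup>2)"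
    by (intro ennreal_leI) simp
  also have "\<dots> \<le> ennreal ?E * (\<integral>\<^sup>+X. ennreal ((T X - N0)\<^sup>2) \<partial>sample_law n f0) + (risk n T F)\<^sup>2"
  proof (rule mixture_lower_bound[where \<Omega> = signs and q = perturbed])
    show "(\<Sum>w\<in>signs. \<Sum>w'\<in>signs.
        (\<integral>\<^sup>+x. ennreal (perturbed w x * perturbed w' x / f0 x) \<partial>lborel) ^ n)
        \<le> ennreal (?E * (real (card signs))\<^sup>2)"
      by (rule likelihood_second_moment)
    show "(\<integral>\<^sup>+X. ennreal ((T X - N1)\<^sup>2) \<partial>sample_law n (perturbed w)) \<le> (risk n T F)\<^sup>2"
      if "w \<in> signs" for w
      using square_risk_ge[OF F[OF that] norm1[OF that]] N by simp
  qed (auto simp: finite_signs signs_nonempty f0_nonneg perturbed_range(1) perturbed_eq_0 T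
      nn_integral_eq_1 f0_integral perturbed_integral)
  also have "\<dots> \<le> ennreal ?E * (risk n T F0)\<^sup>2 + (risk n T F)\<^sup>2"
    by (intro add_right_mono mult_left_mono square_risk_ge[OF f0 norm0 N(1)]) simp
  finally show ?thesis .
qed

end

subsection \<open>Bumps on a lattice of cells\<close>

lemma integral_bounded_support:
  fixes g :: "real^'d::finite \<Rightarrow> real"
  assumes [measurable]: "g \<in> borel_measurable borel"
    and "\<And>x. \<bar>g x\<bar> \<le> 1" "\<And>x. x \<notin> cbox a b \<Longrightarrow> g x = 0" "\<And>i. a $ i \<le> b $ i"
  shows "integrable lborel g" "(LINT x|lborel. g x) \<le> (\<Prod>i\<in>UNIV. b $ i - a $ i)"
proof -
  have ind: "integrable lborel (indicator (cbox a b) :: _ \<Rightarrow> real)"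
    using emeasure_lborel_cbox_finite[of a b] by simp
  have le: "\<bar>g x\<bar> \<le> indicator (cbox a b) x" for x
    using assms(2,3)[of x] by (auto simp: indicator_def)
  show int: "integrable lborel g"
    by (rule Bochner_Integration.integrable_bound[OF ind]) (use le in auto)
  have "(LINT x|lborel. g x) \<le> (LINT x|lborel. indicator (cbox a b) x)"
    by (rule Bochner_Integration.integral_mono[OF int ind]) (use le in \<open>simp add: abs_le_iff\<close>)
  also have "\<dots> = (\<Prod>i\<in>UNIV. b $ i - a $ i)"
    using emeasure_cbox_cart[OF assms(4)] assms(4) by (simp add: measure_def prod_nonneg)
  finally show "(LINT x|lborel. g x) \<le> (\<Prod>i\<in>UNIV. b $ i - a $ i)" .
qed

lemma integral_ge_volume:
  fixes g :: "real^'d::finite \<Rightarrow> real"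
  assumes "integrable lborel g" "\<And>x. 0 \<le> g x" "\<And>x. x \<in> cbox a b \<Longrightarrow> 1 \<le> g x"
    and "\<And>i. a $ i \<le> b $ i"
  shows "(\<Prod>i\<in>UNIV. b $ i - a $ i) \<le> (LINT x|lborel. g x)"
proof -
  have ind: "integrable lborel (indicator (cbox a b) :: _ \<Rightarrow> real)"
    using emeasure_lborel_cbox_finite[of a b] by simp
  have "(\<Prod>i\<in>UNIV. b $ i - a $ i) = (LINT x|lborel. indicator (cbox a b) x)"
    using emeasure_cbox_cart[OF assms(4)] assms(4) by (simp add: measure_def prod_nonneg)
  also have "\<dots> \<le> (LINT x|lborel. g x)"
    by (rule Bochner_Integration.integral_mono[OF ind assms(1)])
      (use assms(2,3) in \<open>auto simp: indicator_def\<close>)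
  finally show ?thesis .
qed

lemma has_bochner_integral_translation:
  fixes g :: "'a::euclidean_space \<Rightarrow> real"
  assumes "has_bochner_integral lborel g s"
  shows "has_bochner_integral lborel (\<lambda>x. g (c + x)) s"
proof -
  have [measurable]: "g \<in> borel_measurable borel"
    using borel_measurable_has_bochner_integral[OF assms] by simp
  have "integrable (distr lborel borel ((+) c)) g" "integral\<^sup>L (distr lborel borel ((+) c)) g = s"
    using assms by (simp_all add: lborel_distr_plus has_bochner_integral_iff)
  then show ?thesis
    by (simp add: has_bochner_integral_iff integrable_distr_eq integral_distr)
qed

text \<open>
  The cube \<open>[0, N]\<^sup>d\<close>, on which \<open>base\<close> is constant, is cut into \<open>\<Prod>\<^sub>i M i\<close> equal cells, each of
  which carries one bump. The direction \<open>j0\<close> is singled out to give the bumps mean zero.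
\<close>

locale bump_lattice =
  fixes k :: nat and P :: "real \<Rightarrow> real" and C N :: real and M :: "'d::finite \<Rightarrow> nat" and j0 :: 'd
  assumes P_cont: "continuous_on UNIV P" and P_nonneg: "0 \<le> P t" and P_le_1: "P t \<le> 1"
    and P_plateau: "0 \<le> t \<Longrightarrow> t \<le> 1 \<Longrightarrow> P t = 1"
    and P_support: "t \<le> -1 \<or> t \<ge> 2 \<Longrightarrow> P t = 0"
    and P_holder: "holder_bound k P C" and C_nonneg: "0 \<le> C"
    and N_pos: "0 < N" and M_pos: "0 < M i"
begin

text \<open>The argument 8 t - 1 squeezes the support of \<open>P\<close> into [0, 3/8] and its
  plateau into [1/8, 1/4]; 8 t - 5 is the same shifted by 1/2, still inside the unit cell, so the
  difference integrates to zero. The spelling \<open>+ - 1\<close> matches the affine form of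
  \<open>holder_bound_affine\<close>.\<close>

definition profile :: "'d \<Rightarrow> real \<Rightarrow> real" where
  "profile i t = (if i = j0 then P (8 * t + - 1) - P (8 * t + - 5) else P (8 * t + - 1))"

definition bump :: "('d \<Rightarrow> nat) \<Rightarrow> real^'d \<Rightarrow> real" where
  "bump m x = (\<Prod>i\<in>UNIV. profile i ((real (M i) / N) * x $ i + - real (m i)))"

text \<open>The summand 0 keeps the affine form of \<open>fdiff_pow_prod_holder\<close>.\<close>

definition plateau :: "real^'d \<Rightarrow> real" where
  "plateau x = (\<Prod>i\<in>UNIV. P (1 / N * x $ i + 0))"

definition height :: real where
  "height = 1 / (LINT x|lborel. plateau x)"

definition base :: "real^'d \<Rightarrow> real" where
  "base x = height * plateau x"

definition cells :: "('d \<Rightarrow> nat) set" where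
  "cells = PiE UNIV (\<lambda>i. {..<M i})"

section \<open>Supports, ranges and integrals of the profiles, the base density and the
  bumps\<close>

lemma measurable_P [measurable]: "P \<in> borel_measurable borel"
  using P_cont by (rule borel_measurable_continuous_onI)

lemma finite_cells: "finite cells"
  unfolding cells_def by (intro finite_PiE) auto

lemma card_cells: "card cells = (\<Prod>i\<in>UNIV. M i)"
  unfolding cells_def by (simp add: card_PiE)

lemma card_cells_pos: "0 < card cells"
  using M_pos by (simp add: card_cells)

lemma P_abs: "\<bar>P t\<bar> \<le> 1"
  using P_nonneg P_le_1 by simp

lemma P_nonzero: "P t \<noteq> 0 \<Longrightarrow> -1 < t \<and> t < 2"
  using P_support by (meson not_le)

lemma profile_abs: "\<bar>profile i t\<bar> \<le> 1"
  using P_nonneg[of "8 * t + - 1"] P_le_1[of "8 * t + - 1"]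
    P_nonneg[of "8 * t + - 5"] P_le_1[of "8 * t + - 5"]
  by (auto simp: profile_def abs_le_iff)

lemma profile_support:
  assumes "profile i t \<noteq> 0" shows "0 < t \<and> t < 1"
proof (rule ccontr)
  assume "\<not> (0 < t \<and> t < 1)"
  then have "t \<le> 0 \<or> t \<ge> 1" by linarith
  then have "P (8 * t + - 1) = 0" "P (8 * t + - 5) = 0"
    by (auto intro!: P_support)
  then show False using assms by (auto simp: profile_def split: if_splits)
qed

lemma profile_eq_1: "1 / 8 \<le> t \<Longrightarrow> t \<le> 1 / 4 \<Longrightarrow> profile i t = 1"
  using P_plateau[of "8 * t + - 1"] P_support[of "8 * t + - 5"]
  by (auto simp: profile_def)

lemma measurable_profile [measurable]: "profile i \<in> borel_measurable borel"
proof -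
  have "(\<lambda>t. P (8 * t + c)) \<in> borel_measurable borel" for c by measurable
  then show ?thesis by (cases "i = j0") (simp_all add: profile_def[abs_def])
qed

text \<open>The dilation costs \<open>8 powr \<beta>\<close>, at most \<open>8 ^ k\<close>; the
  factor 2 is for the two pieces in direction \<open>j0\<close>.\<close>

lemma profile_holder: "holder_bound k (profile i) (2 * 8 ^ k * C)"
  unfolding holder_bound_def
proof (intro allI impI)
  fix u x \<beta> :: real assume \<beta>: "0 < \<beta>" "\<beta> < real k"
  have "8 powr \<beta> \<le> 8 powr real k" using \<beta> by (intro powr_mono) auto
  then have pow8: "8 powr \<beta> \<le> (8::real) ^ k" by (simp add: powr_realpow)
  have one: "\<bar>(rdiff u ^^ k) (\<lambda>t. P (8 * t + c)) x\<bar> \<le> 8 ^ k * C * \<bar>u\<bar> powr \<beta>" for c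
  proof -
    have "\<bar>(rdiff u ^^ k) (\<lambda>t. P (8 * t + c)) x\<bar> \<le> C * \<bar>8 * u\<bar> powr \<beta>"
      by (rule holder_bound_affine[OF P_holder \<beta>])
    also have "\<dots> = (8 powr \<beta>) * (C * \<bar>u\<bar> powr \<beta>)" by (simp add: abs_mult powr_mult)
    also have "\<dots> \<le> 8 ^ k * (C * \<bar>u\<bar> powr \<beta>)"
      using pow8 C_nonneg by (intro mult_right_mono) auto
    finally show ?thesis by (simp add: mult_ac)
  qed
  show "\<bar>(rdiff u ^^ k) (profile i) x\<bar> \<le> 2 * 8 ^ k * C * \<bar>u\<bar> powr \<beta>"
  proof (cases "i = j0")
    case True
    then have "profile i = (\<lambda>t. P (8 * t + - 1) - P (8 * t + - 5))" by (auto simp: profile_def)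
    then have "(rdiff u ^^ k) (profile i) x
        = (rdiff u ^^ k) (\<lambda>t. P (8 * t + - 1)) x - (rdiff u ^^ k) (\<lambda>t. P (8 * t + - 5)) x"
      by (simp only: rdiff_pow_diff)
    then show ?thesis using one[of "-1"] one[of "-5"] by linarith
  next
    case False
    then have "profile i = (\<lambda>t. P (8 * t + - 1))" by (auto simp: profile_def)
    moreover have "0 \<le> 8 ^ k * C * \<bar>u\<bar> powr \<beta>" using C_nonneg by simp
    ultimately show ?thesis using one[of "-1"] by simp
  qed
qed

lemma measurable_plateau [measurable]: "plateau \<in> borel_measurable borel"
  unfolding plateau_def[abs_def] by measurable

lemma measurable_bump [measurable]: "bump m \<in> borel_measurable borel"
  unfolding bump_def[abs_def] by measurable

lemma plateau_range: "0 \<le> plateau x" "plateau x \<le> 1"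
  unfolding plateau_def using P_nonneg P_le_1 by (auto intro!: prod_nonneg prod_le_1)

lemma plateau_eq_1:
  assumes "\<And>i. 0 \<le> x $ i \<and> x $ i \<le> N" shows "plateau x = 1"
  unfolding plateau_def using assms N_pos by (intro prod.neutral ballI P_plateau) auto

lemma plateau_eq_0:
  assumes "x \<notin> cbox (\<chi> i. - N) (\<chi> i. 2 * N)" shows "plateau x = 0"
proof -
  obtain i where "x $ i \<le> - N \<or> x $ i \<ge> 2 * N"
    using assms by (auto simp: mem_box_cart not_le intro: less_imp_le)
  then have "P (1 / N * x $ i + 0) = 0"
    using N_pos by (intro P_support) (auto simp: field_simps)
  then show ?thesis unfolding plateau_def by (intro prod_zero) auto
qed

lemma plateau_integral:
  "integrable lborel plateau" "(N ^ CARD('d)) \<le> (LINT x|lborel. plateau x)" "(LINT x|lborel. plateau x) \<le> 3 ^ CARD('d) * (N ^ CARD('d))"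
proof -
  have abs: "\<bar>plateau x\<bar> \<le> 1" for x using plateau_range[of x] by simp
  show int: "integrable lborel plateau"
    by (rule integral_bounded_support[OF measurable_plateau abs plateau_eq_0]) (use N_pos in auto)
  have "(LINT x|lborel. plateau x)
      \<le> (\<Prod>i\<in>UNIV. (\<chi> i. 2 * N :: real^'d) $ i - (\<chi> i. - N) $ i)"
    by (rule integral_bounded_support[OF measurable_plateau abs plateau_eq_0]) (use N_pos in auto)
  also have "\<dots> = (3 * N) ^ CARD('d)" by simp
  finally show "(LINT x|lborel. plateau x) \<le> 3 ^ CARD('d) * (N ^ CARD('d))"
    by (simp only: power_mult_distrib)
  have "(\<Prod>i\<in>UNIV. (\<chi> i. N :: real^'d) $ i - 0 $ i) \<le> (LINT x|lborel. plateau x)"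
    by (rule integral_ge_volume[OF int plateau_range(1)])
      (use N_pos plateau_eq_1 in \<open>auto simp: mem_box_cart\<close>)
  then show "(N ^ CARD('d)) \<le> (LINT x|lborel. plateau x)" by simp
qed

lemma vol_pos: "0 < (N ^ CARD('d))"
  using N_pos by simp

lemma height_bounds: "0 < height" "height \<le> 1 / (N ^ CARD('d))" "1 / (3 ^ CARD('d) * (N ^ CARD('d))) \<le> height"
proof -
  have pos: "0 < (LINT x|lborel. plateau x)" using plateau_integral(2) vol_pos by linarith
  show "0 < height" using pos by (simp add: height_def)
  show "height \<le> 1 / (N ^ CARD('d))"
    unfolding height_def using plateau_integral(2) vol_pos pos by (intro divide_left_mono) auto
  show "1 / (3 ^ CARD('d) * (N ^ CARD('d))) \<le> height"
    unfolding height_def using plateau_integral(3) vol_pos pos by (intro divide_left_mono) auto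
qed

lemma base_integral: "has_bochner_integral lborel base 1"
  using plateau_integral(1) height_bounds(1)
  by (auto simp: has_bochner_integral_iff base_def[abs_def] height_def)

lemma cell_coord:
  assumes "bump m x \<noteq> 0"
  shows "real (m i) < real (M i) / N * x $ i \<and> real (M i) / N * x $ i < real (m i) + 1"
proof -
  have "profile i (real (M i) / N * x $ i + - real (m i)) \<noteq> 0"
    using assms unfolding bump_def by (simp add: prod_zero_iff)
  from profile_support[OF this] show ?thesis by linarith
qed

lemma bump_abs: "\<bar>bump m x\<bar> \<le> 1"
  unfolding bump_def abs_prod by (rule prod_le_1) (auto simp: profile_abs)

lemma bump_eq_0:
  assumes "x \<notin> cbox (\<chi> i. N / M i * m i) (\<chi> i. N / M i * (real (m i) + 1))"
  shows "bump m x = 0"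
proof (rule ccontr)
  assume nz: "bump m x \<noteq> 0"
  have "N / M i * m i \<le> x $ i \<and> x $ i \<le> N / M i * (real (m i) + 1)" for i
    using cell_coord[OF nz, of i] N_pos M_pos[of i] by (auto simp: field_simps)
  then show False using assms by (auto simp: mem_box_cart)
qed

lemma bump_disjoint:
  assumes "bump m x \<noteq> 0" "bump m' x \<noteq> 0" shows "m = m'"
proof
  fix i
  show "m i = m' i" using cell_coord[OF assms(1), of i] cell_coord[OF assms(2), of i] by linarith
qed

lemma base_on_bump:
  assumes "m \<in> cells" "bump m x \<noteq> 0" shows "base x = height"
proof -
  have "0 \<le> x $ i \<and> x $ i \<le> N" for i
  proof -
    note c = cell_coord[OF assms(2), of i]
    have "m i < M i" using assms(1) by (auto simp: cells_def PiE_def)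
    then have "real (m i) + 1 \<le> real (M i)" by linarith
    then have "real (M i) / N * x $ i < real (M i)" using c by linarith
    moreover have "0 < real (M i) / N * x $ i" using c by (meson of_nat_0_le_iff le_less_trans)
    ultimately show ?thesis
      using N_pos M_pos[of i] by (auto simp: field_simps zero_less_mult_iff)
  qed
  then show ?thesis by (simp add: base_def plateau_eq_1)
qed

lemma bump_integral: "has_bochner_integral lborel (bump m) 0"
proof -
  define H where "H x = (\<Prod>i\<in>UNIV. P (8 * (real (M i) / N * x $ i + - real (m i)) + - 1))" for x :: "real^'d"
  \<comment> \<open>Half a cell along \<open>j0\<close>: in the argument of \<open>P\<close> this
    shift amounts to 8 * 1/2 = 4 and turns -1 into -5. So the bump is \<open>H\<close> minus a
    translate of \<open>H\<close>.\<close>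
  define c where "c = - (N / (2 * M j0)) *\<^sub>R (axis j0 1 :: real^'d)"
  have H_abs: "\<bar>H x\<bar> \<le> 1" for x
    unfolding H_def abs_prod by (rule prod_le_1) (use P_abs in auto)
  have H_supp: "H x = 0" if "x \<notin> cbox (\<chi> i. N / M i * m i) (\<chi> i. N / M i * (real (m i) + 1))" for x
  proof (rule ccontr)
    assume nz: "H x \<noteq> 0"
    have "N / M i * m i \<le> x $ i \<and> x $ i \<le> N / M i * (real (m i) + 1)" for i
    proof -
      have "P (8 * (real (M i) / N * x $ i + - real (m i)) + - 1) \<noteq> 0"
        using nz unfolding H_def by (simp add: prod_zero_iff)
      then have "real (m i) < real (M i) / N * x $ i \<and> real (M i) / N * x $ i < real (m i) + 1"
        using P_nonzero[of "8 * (real (M i) / N * x $ i + - real (m i)) + - 1"] by simp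
      then show ?thesis using N_pos M_pos[of i] by (auto simp: field_simps)
    qed
    then show False using that by (auto simp: mem_box_cart)
  qed
  have H_meas: "H \<in> borel_measurable borel" unfolding H_def[abs_def] by measurable
  have "integrable lborel H"
    by (rule integral_bounded_support[OF H_meas H_abs H_supp])
      (use N_pos M_pos in \<open>auto simp: field_simps\<close>)
  then have "has_bochner_integral lborel H (LINT x|lborel. H x)"
    by (simp add: has_bochner_integral_iff)
  then have "has_bochner_integral lborel (\<lambda>x. H x - H (c + x)) ((LINT x|lborel. H x) - (LINT x|lborel. H x))"
    by (intro has_bochner_integral_diff has_bochner_integral_translation)
  moreover have "H x - H (c + x) = bump m x" for x
  proof -
    let ?p = "\<lambda>i y. P (8 * (real (M i) / N * y + - real (m i)) + - 1)"
    let ?R = "\<Prod>i\<in>UNIV - {j0}. ?p i (x $ i)"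
    have Hx: "H x = ?p j0 (x $ j0) * ?R" unfolding H_def by (simp add: prod.remove[of UNIV j0])
    have Hcx: "H (c + x) = ?p j0 ((c + x) $ j0) * (\<Prod>i\<in>UNIV - {j0}. ?p i ((c + x) $ i))"
      unfolding H_def by (simp add: prod.remove[of UNIV j0])
    have R: "(\<Prod>i\<in>UNIV - {j0}. ?p i ((c + x) $ i)) = ?R"
      by (rule prod.cong) (auto simp: c_def axis_def)
    have arg: "8 * (real (M j0) / N * (c + x) $ j0 + - real (m j0)) + - 1
        = 8 * (real (M j0) / N * x $ j0 + - real (m j0)) + - 5"
      using N_pos M_pos[of j0] by (simp add: c_def axis_def field_simps)
    have bx: "bump m x = profile j0 (real (M j0) / N * x $ j0 + - real (m j0)) * ?R"
      unfolding bump_def by (simp add: prod.remove[of UNIV j0] profile_def)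
    have "profile j0 t = P (8 * t + - 1) - P (8 * t + - 5)" for t by (simp add: profile_def)
    then show ?thesis by (simp only: Hx Hcx R arg bx left_diff_distrib)
  qed
  ultimately show ?thesis by simp
qed

sublocale perturbed_density base height cells bump
proof
  show "finite cells" by (rule finite_cells)
  show "0 < height" by (rule height_bounds)
  show "0 \<le> base x" "base x \<le> height" for x
    using plateau_range[of x] height_bounds(1) mult_left_le[of "plateau x" height]
    by (auto simp: base_def mult_left_le)
  show "has_bochner_integral lborel base 1" by (rule base_integral)
  show "\<bar>bump m x\<bar> \<le> 1" for m x by (rule bump_abs)
  show "has_bochner_integral lborel (bump m) 0" for m by (rule bump_integral)
  show "m = m'" if "bump m x \<noteq> 0" "bump m' x \<noteq> 0" for m m' x using bump_disjoint that by blast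
  show "base x = height" if "m \<in> cells" "bump m x \<noteq> 0" for m x using base_on_bump that by blast
qed

lemma cell_volume:
  "(\<Prod>i\<in>UNIV. c * (N / M i)) = c ^ CARD('d) * (N ^ CARD('d)) / card cells"
  by (simp add: prod.distrib prod_dividef card_cells power_mult_distrib flip: of_nat_prod)

text \<open>For the lower bound, the bump equals 1 on the sub-box with relative coordinates in
  [1/8, 1/4], whose sides are one eighth of those of the cell.\<close>

lemma energy_bounds: "(N ^ CARD('d)) / (8 ^ CARD('d) * card cells) \<le> energy m" "energy m \<le> (N ^ CARD('d)) / card cells"
proof -
  have le1: "\<bar>(bump m x)\<^sup>2\<bar> \<le> 1" for x
    using bump_abs[of m x] abs_square_le_1[of "bump m x"] by simp
  have t_diff: "t * (z + 1) - t * z = 1 * t" "t * (z + 1 / 4) - t * (z + 1 / 8) = 1 / 8 * t"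
    for t z :: real by (simp_all add: algebra_simps)
  have int: "integrable lborel (\<lambda>x. (bump m x)\<^sup>2)"
    using \<Lambda>_square_integral by (simp add: has_bochner_integral_iff)
  have "energy m \<le> (\<Prod>i\<in>UNIV. (\<chi> i. N / M i * (real (m i) + 1) :: real^'d) $ i - (\<chi> i. N / M i * m i) $ i)"
    unfolding energy_def
    by (rule integral_bounded_support[OF _ le1]) (use bump_eq_0 N_pos in \<open>auto simp: divide_right_mono\<close>)
  also have "\<dots> = (\<Prod>i\<in>UNIV. 1 * (N / M i))"
    by (rule prod.cong) (simp_all only: vec_lambda_beta t_diff)
  finally show "energy m \<le> (N ^ CARD('d)) / card cells" unfolding cell_volume by simp
  have "(\<Prod>i\<in>UNIV. (\<chi> i. N / M i * (m i + 1 / 4) :: real^'d) $ i - (\<chi> i. N / M i * (m i + 1 / 8)) $ i)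
      \<le> energy m"
    unfolding energy_def
  proof (rule integral_ge_volume[OF int])
    fix x :: "real^'d"
    assume x: "x \<in> cbox (\<chi> i. N / M i * (m i + 1 / 8)) (\<chi> i. N / M i * (m i + 1 / 4))"
    have "bump m x = 1"
      unfolding bump_def
    proof (intro prod.neutral ballI profile_eq_1)
      fix i
      have "N / M i * (m i + 1 / 8) \<le> x $ i" "x $ i \<le> N / M i * (m i + 1 / 4)"
        using x by (auto simp: mem_box_cart)
      then show "1 / 8 \<le> real (M i) / N * x $ i + - real (m i)"
        "real (M i) / N * x $ i + - real (m i) \<le> 1 / 4"
        using N_pos M_pos[of i] by (simp_all add: field_simps)
    qed
    then show "1 \<le> (bump m x)\<^sup>2" by simp
  qed (use N_pos in \<open>auto intro!: mult_left_mono divide_right_mono\<close>)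
  also have "(\<Prod>i\<in>UNIV. (\<chi> i. N / M i * (m i + 1 / 4) :: real^'d) $ i - (\<chi> i. N / M i * (m i + 1 / 8)) $ i)
      = (\<Prod>i\<in>UNIV. (1 / 8) * (N / M i))"
    by (rule prod.cong) (simp_all only: vec_lambda_beta t_diff)
  finally show "(N ^ CARD('d)) / (8 ^ CARD('d) * card cells) \<le> energy m"
    unfolding cell_volume by (simp add: power_divide)
qed

text \<open>Height at least 1/(3^d V) and total energy at least V/8^d give the separation, with 1728
  = 3^3 * 8^2. In the exponent, height times energy of a cell is at most one over the number of
  cells; summing the squares over the cells leaves \<open>n\<^sup>2 / card cells\<close>.\<close>

lemma lattice_risk_lower_bound:
  assumes "T \<in> estimators n" "base \<in> F0 \<inter> L2_densities"
    and "\<And>w. w \<in> signs \<Longrightarrow> perturbed w \<in> F \<inter> L2_densities"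
  shows "ennreal (3 / 128 * (1 / (1728 ^ CARD('d) * (N ^ CARD('d)))))
    \<le> ennreal (exp ((real n)\<^sup>2 / card cells)) * (risk n T F0)\<^sup>2 + (risk n T F)\<^sup>2"
proof -
  let ?K = "real (card cells)"
  have K: "0 < ?K" using card_cells_pos by simp
  have "(N ^ CARD('d)) / 8 ^ CARD('d) = (\<Sum>m\<in>cells. (N ^ CARD('d)) / (8 ^ CARD('d) * card cells))"
    using K by simp
  also have "\<dots> \<le> (\<Sum>m\<in>cells. energy m)" by (rule sum_mono) (rule energy_bounds)
  finally have sum_ge: "(N ^ CARD('d)) / 8 ^ CARD('d) \<le> (\<Sum>m\<in>cells. energy m)" .
  have "1 / (1728 ^ CARD('d) * (N ^ CARD('d))) = (1 / (3 ^ CARD('d) * (N ^ CARD('d)))) ^ 3 * ((N ^ CARD('d)) / 8 ^ CARD('d))\<^sup>2"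
  proof -
    have "(1728::real) ^ CARD('d) = (3 ^ CARD('d)) ^ 3 * (8 ^ CARD('d))\<^sup>2"
      by (simp add: power_mult[symmetric] mult.commute[of "CARD('d)"])
        (simp add: power_mult power_mult_distrib[symmetric])
    then show ?thesis
      using vol_pos by (simp add: power_mult_distrib power_divide power2_eq_square power3_eq_cube)
  qed
  also have "\<dots> \<le> height ^ 3 * (\<Sum>m\<in>cells. energy m)\<^sup>2"
    using height_bounds sum_ge vol_pos by (intro mult_mono power_mono) auto
  finally have lower: "3 / 128 * (1 / (1728 ^ CARD('d) * (N ^ CARD('d))))
      \<le> 3 / 128 * (height ^ 3 * (\<Sum>m\<in>cells. energy m)\<^sup>2)"
    by (rule mult_left_mono) simp
  have "(\<Sum>m\<in>cells. (real n * height * energy m)\<^sup>2) \<le> (\<Sum>m\<in>cells. (real n / ?K)\<^sup>2)"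
  proof (rule sum_mono, rule power_mono)
    fix m
    have "height * energy m \<le> (1 / (N ^ CARD('d))) * ((N ^ CARD('d)) / ?K)"
      using height_bounds energy_bounds energy_nonneg vol_pos by (intro mult_mono) auto
    then have "height * energy m \<le> 1 / ?K" using N_pos by simp
    then have "real n * (height * energy m) \<le> real n * (1 / ?K)" by (rule mult_left_mono) simp
    then show "real n * height * energy m \<le> real n / ?K" by (simp add: mult.assoc)
    show "0 \<le> real n * height * energy m"
      using height_bounds(1) energy_nonneg by (simp add: less_imp_le)
  qed
  also have "\<dots> = (real n)\<^sup>2 / ?K"
    using K by (simp add: power_divide power2_eq_square)
  finally have "exp (\<Sum>m\<in>cells. (real n * height * energy m)\<^sup>2) \<le> exp ((real n)\<^sup>2 / ?K)" by simp
  then have "ennreal (exp (\<Sum>m\<in>cells. (real n * height * energy m)\<^sup>2)) * (risk n T F0)\<^sup>2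
      + (risk n T F)\<^sup>2 \<le> ennreal (exp ((real n)\<^sup>2 / ?K)) * (risk n T F0)\<^sup>2 + (risk n T F)\<^sup>2"
    by (intro add_right_mono mult_right_mono ennreal_leI) auto
  then show ?thesis
    using order_trans[OF ennreal_leI[OF lower] risk_lower_bound[OF assms]] by (rule order_trans[rotated])
qed

section \<open>Smoothness of the base density and of its perturbations\<close>

lemma fdiff_base_bound:
  assumes "0 < \<beta>" "\<beta> < real k"
  shows "\<bar>(fdiff u j ^^ k) base x\<bar> \<le> height * C * (\<bar>u\<bar> / N) powr \<beta>"
proof -
  have "\<bar>(fdiff u j ^^ k) plateau x\<bar> \<le> C * (1 / N * \<bar>u\<bar>) powr \<beta>"
    unfolding plateau_def[abs_def]
    by (rule fdiff_pow_prod_holder[where a = "\<lambda>_. 1 / N" and c = "\<lambda>_. 0"])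
      (use P_abs P_holder C_nonneg assms N_pos in auto)
  then have "height * \<bar>(fdiff u j ^^ k) plateau x\<bar> \<le> height * (C * (1 / N * \<bar>u\<bar>) powr \<beta>)"
    using height_bounds(1) by (intro mult_left_mono) auto
  moreover have "(fdiff u j ^^ k) base x = height * (fdiff u j ^^ k) plateau x"
    using fdiff_pow_linear[where I = "{}::nat set" and u = u and j = j and k = k
        and a = height and f = plateau] by (simp add: base_def[abs_def])
  ultimately show ?thesis using height_bounds(1) by (simp add: abs_mult)
qed

lemma fdiff_bump_bound:
  assumes "0 < \<beta>" "\<beta> < real k"
  shows "\<bar>(fdiff u j ^^ k) (bump m) x\<bar> \<le> 2 * 8 ^ k * C * (real (M j) / N * \<bar>u\<bar>) powr \<beta>"
  unfolding bump_def[abs_def]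
  by (rule fdiff_pow_prod_holder[where a = "\<lambda>i. real (M i) / N" and c = "\<lambda>i. - real (m i)"])
    (use profile_abs profile_holder C_nonneg assms N_pos M_pos in auto)

text \<open>A bump contributes only if it is nonzero at one of the points \<open>x + i u e\<^sub>j\<close>, \<open>i \<le> k\<close>.\<close>

lemma card_fdiff_bump_nonzero: "card {m \<in> cells. (fdiff u j ^^ k) (bump m) x \<noteq> 0} \<le> k + 1"
proof -
  define y where "y i = x + (real i * u) *\<^sub>R axis j 1" for i
  have "{m \<in> cells. (fdiff u j ^^ k) (bump m) x \<noteq> 0} \<subseteq> (\<Union>i\<in>{..k}. {m. bump m (y i) \<noteq> 0})"
    using fdiff_pow_eq_0[of k _ x u j] unfolding y_def by blast
  moreover have one: "finite {m. bump m z \<noteq> 0} \<and> card {m. bump m z \<noteq> 0} \<le> 1" for z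
  proof -
    obtain m0 where sub: "{m. bump m z \<noteq> 0} \<subseteq> {m0}"
      using bump_disjoint[of _ z] by blast
    then show ?thesis using card_mono[OF _ sub] finite_subset[OF sub] by simp
  qed
  ultimately have "card {m \<in> cells. (fdiff u j ^^ k) (bump m) x \<noteq> 0}
      \<le> card (\<Union>i\<in>{..k}. {m. bump m (y i) \<noteq> 0})"
    by (intro card_mono) auto
  also have "\<dots> \<le> (\<Sum>i\<in>{..k}. card {m. bump m (y i) \<noteq> 0})"
    by (rule card_UN_le) simp
  also have "\<dots> \<le> (\<Sum>i\<in>{..k}. 1)"
    using one by (intro sum_mono) blast
  finally show ?thesis by simp
qed

text \<open>At a given x at most k + 1 bumps contribute, however many cells there are. The base
  density counts as one more term, giving k + 2, since it varies on the longer scale N and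
  \<open>M j \<ge> 1\<close>.\<close>

lemma fdiff_perturbed_bound:
  assumes w: "w \<in> signs" and \<beta>: "0 < \<beta>" "\<beta> < real k"
  shows "\<bar>(fdiff u j ^^ k) (perturbed w) x\<bar>
    \<le> height * (real (k + 2) * (2 * 8 ^ k * C)) * (real (M j) / N * \<bar>u\<bar>) powr \<beta>"
proof -
  let ?B = "2 * 8 ^ k * C * (real (M j) / N * \<bar>u\<bar>) powr \<beta>"
  let ?S = "{m \<in> cells. (fdiff u j ^^ k) (bump m) x \<noteq> 0}"
  have B0: "0 \<le> ?B" using C_nonneg by simp
  have lin: "(fdiff u j ^^ k) (perturbed w) x
      = (fdiff u j ^^ k) base x + (\<Sum>m\<in>cells. height * w m * (fdiff u j ^^ k) (bump m) x)"
    using fdiff_pow_linear[OF finite_cells, where u = u and j = j and k = k and a = 1 and f = base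
        and w = "\<lambda>m. height * w m" and g = bump]
    by (simp add: perturbed_def[abs_def] sum_distrib_left mult.assoc)
  have "\<bar>\<Sum>m\<in>cells. height * w m * (fdiff u j ^^ k) (bump m) x\<bar>
      \<le> (\<Sum>m\<in>cells. \<bar>height * w m * (fdiff u j ^^ k) (bump m) x\<bar>)"
    by (rule sum_abs)
  also have "\<dots> = (\<Sum>m\<in>?S. \<bar>height * w m * (fdiff u j ^^ k) (bump m) x\<bar>)"
    using finite_cells by (intro sum.mono_neutral_right) auto
  also have "\<dots> \<le> (\<Sum>m\<in>?S. height * ?B)"
  proof (rule sum_mono)
    fix m assume "m \<in> ?S"
    then have "\<bar>w m\<bar> = 1" using w by (auto simp: signs_def PiE_def Pi_def)
    then show "\<bar>height * w m * (fdiff u j ^^ k) (bump m) x\<bar> \<le> height * ?B"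
      using fdiff_bump_bound[OF \<beta>, of u j m x] height_bounds(1) by (simp add: abs_mult)
  qed
  also have "\<dots> = real (card ?S) * (height * ?B)" by simp
  also have "\<dots> \<le> real (k + 1) * (height * ?B)"
    using card_fdiff_bump_nonzero B0 height_bounds(1) by (intro mult_right_mono) (simp_all only: of_nat_le_iff, simp)
  finally have 1: "\<bar>\<Sum>m\<in>cells. height * w m * (fdiff u j ^^ k) (bump m) x\<bar>
      \<le> real (k + 1) * (height * ?B)" .
  have "\<bar>(fdiff u j ^^ k) base x\<bar> \<le> height * C * (\<bar>u\<bar> / N) powr \<beta>"
    by (rule fdiff_base_bound[OF \<beta>])
  also have "\<dots> \<le> height * (2 * 8 ^ k * C) * (real (M j) / N * \<bar>u\<bar>) powr \<beta>"
  proof (intro mult_mono powr_mono2)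
    have "(1::real) \<le> 2 * 8 ^ k" using one_le_power[of "8::real" k] by linarith
    then show "C \<le> 2 * 8 ^ k * C" using C_nonneg by (simp add: mult_left_le_one_le mult_le_cancel_right1)
    have "1 * (\<bar>u\<bar> / N) \<le> real (M j) * (\<bar>u\<bar> / N)"
      using M_pos[of j] N_pos by (intro mult_right_mono) auto
    then show "\<bar>u\<bar> / N \<le> real (M j) / N * \<bar>u\<bar>" by simp
  qed (use height_bounds(1) C_nonneg \<beta> N_pos in auto)
  finally have 2: "\<bar>(fdiff u j ^^ k) base x\<bar> \<le> height * ?B" by (simp add: mult.assoc)
  have "real (k + 2) * (height * ?B) = height * ?B + real (k + 1) * (height * ?B)"
    by (simp add: algebra_simps)
  then have "\<bar>(fdiff u j ^^ k) (perturbed w) x\<bar> \<le> real (k + 2) * (height * ?B)"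
    using lin 1 2 by linarith
  then show ?thesis by (simp add: mult_ac)
qed

lemma perturbed_eq_0_outside:
  assumes "x \<notin> cbox (\<chi> i. - N) (\<chi> i. 2 * N)" shows "perturbed w x = 0"
  using plateau_eq_0[OF assms] by (intro perturbed_eq_0) (simp add: base_def)

end

subsection \<open>The lower bound\<close>

lemma eventually_const_times_powr_neg_le:
  fixes a \<beta> L :: real
  assumes "0 < \<beta>" "0 < L"
  shows "\<forall>\<^sub>F x in at_top. a * x powr (- \<beta>) \<le> L"
proof -
  have "((\<lambda>x. a * x powr (- \<beta>)) \<longlongrightarrow> a * 0) at_top"
    using assms by (intro tendsto_intros tendsto_neg_powr filterlim_ident) auto
  then have "\<forall>\<^sub>F x in at_top. a * x powr (- \<beta>) < L"
    using assms(2) by (intro order_tendstoD(2)) auto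
  then show ?thesis by eventually_elim simp
qed

text \<open>With \<rho> = 1/p this bounds the L_p norm of a density of height at most 2/v on a set
  of volume w v; it decays like \<open>v powr (- (1 - \<rho>))\<close>, which needs p > 1.\<close>

lemma eventually_spread_norm_le:
  fixes w \<rho> L :: real
  assumes "\<rho> < 1" "0 < L" "0 < w"
  shows "\<forall>\<^sub>F v in at_top. 2 / v * (w * v) powr \<rho> \<le> L"
proof -
  have "\<forall>\<^sub>F v in at_top. 2 * w powr \<rho> * v powr (- (1 - \<rho>)) \<le> L"
    using assms by (intro eventually_const_times_powr_neg_le) auto
  then show ?thesis
    using eventually_gt_at_top[of 0]
  proof eventually_elim
    case (elim v)
    have "2 / v * (w * v) powr \<rho> = 2 * w powr \<rho> * v powr (- (1 - \<rho>))"
      using elim(2) \<open>0 < w\<close> by (simp add: powr_mult powr_diff)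
    then show ?case using elim(1) by simp
  qed
qed

lemma powr_le_self:
  fixes x \<rho> :: real
  assumes "1 \<le> x" "\<rho> \<le> 1" shows "x powr \<rho> \<le> x"
  using powr_mono[OF assms(2,1)] assms(1) by simp

lemma nat_floor_ge_half:
  fixes y :: real
  assumes "1 \<le> y" shows "y / 2 \<le> real (nat \<lfloor>y\<rfloor>)" "0 < nat \<lfloor>y\<rfloor>" "real (nat \<lfloor>y\<rfloor>) \<le> y"
proof -
  have "1 \<le> \<lfloor>y\<rfloor>" using assms by simp
  then have "real (nat \<lfloor>y\<rfloor>) = of_int \<lfloor>y\<rfloor>" "1 \<le> real (nat \<lfloor>y\<rfloor>)" by (simp_all add: of_nat_nat)
  moreover have "y < of_int \<lfloor>y\<rfloor> + 1" "of_int \<lfloor>y\<rfloor> \<le> y" by linarith+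
  ultimately show "y / 2 \<le> real (nat \<lfloor>y\<rfloor>)" "0 < nat \<lfloor>y\<rfloor>" "real (nat \<lfloor>y\<rfloor>) \<le> y"
    by linarith+
qed

context bump_lattice
begin

text \<open>One criterion for both hypotheses: twice \<open>height\<close> bounds
  \<open>base\<close> and every \<open>perturbed w\<close>, and all of them live in a box of volume
  (3 N)^d. Replacing \<open>height\<close> by 1/N^d leaves conditions that can be checked for large
  N.\<close>

lemma density_mem_fclass:
  fixes g :: "real^'d \<Rightarrow> real" and r :: "ennreal^'d" and \<beta> :: "real^'d"
  assumes f: "g \<in> borel_measurable borel" "\<And>x. 0 \<le> g x" "\<And>x. g x \<le> 2 * height"
      "has_bochner_integral lborel g 1"
    and supp: "\<And>x. x \<notin> cbox (\<chi> i. - N) (\<chi> i. 2 * N) \<Longrightarrow> g x = 0"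
    and r: "\<And>j. 1 \<le> r $ j" "2 \<le> q" and \<beta>: "\<And>j. \<beta> $ j < real k"
    and L1: "\<And>j. r $ j = 1 \<Longrightarrow> 1 \<le> L $ j"
    and La: "\<And>j. r $ j \<noteq> 1 \<Longrightarrow> 2 / N ^ CARD('d) * (3 ^ CARD('d) * N ^ CARD('d)) powr recip (r $ j) \<le> L $ j"
    and Qa: "2 / N ^ CARD('d) * (3 ^ CARD('d) * N ^ CARD('d)) powr recip q \<le> Q"
    and diff: "\<And>u j x. \<bar>(fdiff u j ^^ k) g x\<bar> \<le> height * a j * \<bar>u\<bar> powr (\<beta> $ j)"
    and a: "\<And>j. 0 \<le> a j"
    and Lb: "\<And>j. a j / N ^ CARD('d) * (real (k + 1) * 3 ^ CARD('d) * N ^ CARD('d)) powr recip (r $ j) \<le> L $ j"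
  shows "g \<in> fclass ((\<beta>, r), q) (L, Q) \<inter> L2_densities"
proof (rule fclass_L2_densities_I[OF f(1,2) _ _ supp, where a = "2 / N ^ CARD('d)"
      and v = "3 ^ CARD('d) * N ^ CARD('d)" and b = "\<lambda>j. a j / N ^ CARD('d)" and k = k])
  show "g x \<le> 2 / N ^ CARD('d)" for x using f(3)[of x] height_bounds(2) by (simp add: field_simps)
  show "(\<integral>\<^sup>+x. ennreal (g x) \<partial>lborel) = 1" by (rule nn_integral_eq_1[OF f(4,2)])
  show "(\<Prod>i\<in>UNIV. (\<chi> i. 2 * N :: real^'d) $ i - (\<chi> i. - N) $ i) \<le> 3 ^ CARD('d) * N ^ CARD('d)"
    by (simp add: power_mult_distrib)
  show "\<bar>(fdiff u j ^^ k) g x\<bar> \<le> a j / N ^ CARD('d) * \<bar>u\<bar> powr (\<beta> $ j)" for u j x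
  proof -
    have "height * a j \<le> 1 / N ^ CARD('d) * a j"
      by (rule mult_right_mono[OF height_bounds(2) a])
    then have "height * a j * \<bar>u\<bar> powr (\<beta> $ j) \<le> 1 / N ^ CARD('d) * a j * \<bar>u\<bar> powr (\<beta> $ j)"
      by (rule mult_right_mono) simp
    then show ?thesis using diff[of u j x] by simp
  qed
  show "a j / N ^ CARD('d) * (real (k + 1) * (3 ^ CARD('d) * N ^ CARD('d))) powr recip (r $ j) \<le> L $ j" for j
    using Lb[of j] by (simp only: mult.assoc)
qed (use r \<beta> L1 La Qa N_pos in auto)

end

text \<open>
  The cell side \<open>K V\<^bsup>-(1 - 1/r\<^sub>j)/\<beta>\<^sub>j\<^esup>\<close>, \<open>V = N\<^sup>d\<close>, is the smallest one for which bumps of height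
  \<open>1/V\<close> filling a volume \<open>V\<close> stay in the Nikolskii class; it gives \<open>V\<^bsup>\<tau>(1)\<^esup>\<close> cells up to a constant.
\<close>

lemma risk_lower_bound_large_volume:
  fixes \<beta> \<beta>' :: "real^'d::finite" and r r' :: "ennreal^'d" and L L' :: "real^'d"
  assumes \<beta>: "\<And>j. 0 < \<beta> $ j" "\<And>j. 0 < \<beta>' $ j"
    and r: "\<And>j. 1 \<le> r $ j" "\<And>j. 1 \<le> r' $ j" "2 \<le> q" "2 \<le> q'"
    and L: "\<And>j. 0 < L $ j" "\<And>j. 0 < L' $ j" "0 < Q" "0 < Q'"
    and L1: "\<And>j. r $ j = 1 \<Longrightarrow> 1 \<le> L $ j" "\<And>j. r' $ j = 1 \<Longrightarrow> 1 \<le> L' $ j"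
  obtains c1 c2 where "0 < c1" "0 < c2"
    "\<forall>\<^sub>F N in at_top. \<forall>n. \<forall>T\<in>estimators n. ennreal (c1 / N ^ CARD('d))
      \<le> ennreal (exp (c2 * (real n)\<^sup>2 / (N ^ CARD('d)) powr tau (\<beta>, r) 1))
          * (risk n T (fclass ((\<beta>', r'), q') (L', Q')))\<^sup>2
        + (risk n T (fclass ((\<beta>, r), q) (L, Q)))\<^sup>2"
proof -
  let ?d = "CARD('d)"
  obtain k :: nat where k: "\<And>j. \<beta> $ j < real k" "\<And>j. \<beta>' $ j < real k"
  proof -
    obtain k :: nat where "(\<Sum>j\<in>UNIV. \<beta> $ j) + (\<Sum>j\<in>UNIV. \<beta>' $ j) < real k"
      using reals_Archimedean2 by blast
    moreover have "\<beta> $ j \<le> (\<Sum>j\<in>UNIV. \<beta> $ j)" "\<beta>' $ j \<le> (\<Sum>j\<in>UNIV. \<beta>' $ j)" for j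
      using \<beta> member_le_sum[of j UNIV "\<lambda>j. \<beta> $ j"] member_le_sum[of j UNIV "\<lambda>j. \<beta>' $ j"]
      by (simp_all add: less_imp_le)
    moreover have "0 \<le> (\<Sum>j\<in>UNIV. \<beta> $ j)" "0 \<le> (\<Sum>j\<in>UNIV. \<beta>' $ j)"
      using \<beta> by (simp_all add: sum_nonneg less_imp_le)
    ultimately show ?thesis
      using that[of k] by (meson add_increasing add_increasing2 le_less_trans)
  qed
  have "1 \<le> k" using k(1) \<beta>(1) by (metis less_one not_le of_nat_0 order_less_asym)
  from plateau_exists[OF this] obtain P C where P: "continuous_on UNIV P" "\<And>t. 0 \<le> P t" "\<And>t. P t \<le> 1"
    "\<And>t. 0 \<le> t \<Longrightarrow> t \<le> 1 \<Longrightarrow> P t = 1" "\<And>t. t \<le> -1 \<or> t \<ge> 2 \<Longrightarrow> P t = 0"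
    "holder_bound k P C" "0 \<le> C" by blast
  \<comment> \<open>Volume factor of the differences: k + 1 translates of a box of volume 3^d
    V.\<close>
  define W where "W = real (k + 1) * 3 ^ ?d"
  define C1 where "C1 = real (k + 2) * (2 * 8 ^ k * C)"
  have W: "1 \<le> W"
    using mult_mono[of 1 "real (k + 1)" 1 "3 ^ ?d"] one_le_power[of "3::real" ?d] by (simp add: W_def)
  have C1: "0 \<le> C1" using P(7) by (simp add: C1_def)
  \<comment> \<open>Cells longer by the factor K divide the difference bound of the mixture by
    \<open>K powr \<beta> $ j\<close>. A fixed K therefore brings it below \<open>L $ j\<close>,
    whatever N is.\<close>
  have "\<forall>\<^sub>F K in at_top. \<forall>j\<in>UNIV. C1 * W * K powr (- \<beta> $ j) \<le> L $ j"
    using eventually_const_times_powr_neg_le \<beta> L by (intro eventually_ball_finite) auto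
  then have "\<forall>\<^sub>F K in at_top. (\<forall>j\<in>UNIV. C1 * W * K powr (- \<beta> $ j) \<le> L $ j) \<and> 1 \<le> K"
    using eventually_ge_at_top[of 1] by (rule eventually_conj)
  then obtain K where K: "\<And>j. C1 * W * K powr (- \<beta> $ j) \<le> L $ j" "1 \<le> K"
    by (auto simp: eventually_at_top_linorder)
  have q: "recip q < 1" "recip q' < 1"
  proof -
    have "recip s < 1" if "2 \<le> s" for s
    proof (rule recip_less_1)
      show "1 \<le> s" by (rule order_trans[OF _ that]) simp
      show "s \<noteq> 1" using that by auto
    qed
    then show "recip q < 1" "recip q' < 1" using r by auto
  qed
  have vol: "filterlim (\<lambda>N::real. N ^ ?d) at_top at_top"
    by (rule filterlim_pow_at_top) (auto intro: filterlim_ident)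
  note spread = eventually_compose_filterlim[OF eventually_spread_norm_le vol]
  have ev: "\<forall>\<^sub>F N in at_top.
      (\<forall>j\<in>UNIV. r $ j \<noteq> 1 \<longrightarrow> 2 / N ^ ?d * (3 ^ ?d * N ^ ?d) powr recip (r $ j) \<le> L $ j)
      \<and> (\<forall>j\<in>UNIV. r' $ j \<noteq> 1 \<longrightarrow> 2 / N ^ ?d * (3 ^ ?d * N ^ ?d) powr recip (r' $ j) \<le> L' $ j)
      \<and> 2 / N ^ ?d * (3 ^ ?d * N ^ ?d) powr recip q \<le> Q
      \<and> 2 / N ^ ?d * (3 ^ ?d * N ^ ?d) powr recip q' \<le> Q'
      \<and> (\<forall>j\<in>UNIV. C * W * N powr (- \<beta>' $ j) \<le> L' $ j)
      \<and> K \<le> N"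
  proof (intro eventually_conj eventually_ball_finite ballI)
    show "\<forall>\<^sub>F N in at_top. r $ j \<noteq> 1 \<longrightarrow> 2 / N ^ ?d * (3 ^ ?d * N ^ ?d) powr recip (r $ j) \<le> L $ j" for j
      using spread[of "recip (r $ j)" "L $ j" "3 ^ ?d"] recip_less_1[OF r(1)] L by (cases "r $ j = 1") auto
    show "\<forall>\<^sub>F N in at_top. r' $ j \<noteq> 1 \<longrightarrow> 2 / N ^ ?d * (3 ^ ?d * N ^ ?d) powr recip (r' $ j) \<le> L' $ j" for j
      using spread[of "recip (r' $ j)" "L' $ j" "3 ^ ?d"] recip_less_1[OF r(2)] L by (cases "r' $ j = 1") auto
    show "\<forall>\<^sub>F N in at_top. 2 / N ^ ?d * (3 ^ ?d * N ^ ?d) powr recip q \<le> Q"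
      using spread[of "recip q" Q "3 ^ ?d"] q L by simp
    show "\<forall>\<^sub>F N in at_top. 2 / N ^ ?d * (3 ^ ?d * N ^ ?d) powr recip q' \<le> Q'"
      using spread[of "recip q'" Q' "3 ^ ?d"] q L by simp
    show "\<forall>\<^sub>F N in at_top. C * W * N powr (- \<beta>' $ j) \<le> L' $ j" for j
      using eventually_const_times_powr_neg_le[of "\<beta>' $ j" "L' $ j" "C * W"] \<beta> L by simp
    show "\<forall>\<^sub>F N in at_top. K \<le> N" by (rule eventually_ge_at_top)
  qed auto
  have "\<forall>\<^sub>F N in at_top. \<forall>n. \<forall>T\<in>estimators n.
      ennreal (3 / 128 / 1728 ^ ?d / N ^ ?d)
      \<le> ennreal (exp ((2 * K) ^ ?d * (real n)\<^sup>2 / (N ^ ?d) powr tau (\<beta>, r) 1))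
          * (risk n T (fclass ((\<beta>', r'), q') (L', Q')))\<^sup>2
        + (risk n T (fclass ((\<beta>, r), q) (L, Q)))\<^sup>2"
    using ev
  proof eventually_elim
    case (elim N)
    define V where "V = N ^ ?d"
    have N: "1 \<le> N" "K \<le> N" using elim K(2) by auto
    have V: "1 \<le> V" unfolding V_def by (rule one_le_power[OF N(1)])
    define \<rho> where "\<rho> j = recip (r $ j)" for j
    have \<rho>: "\<rho> j \<le> 1" for j using recip_le_1[OF r(1)] by (simp add: \<rho>_def)
    define s where "s j = K * V powr (- ((1 - \<rho> j) / \<beta> $ j))" for j
    have s: "0 < s j" "s j \<le> K" for j
    proof -
      show "0 < s j" using K(2) V by (simp add: s_def)
      have "V powr (- ((1 - \<rho> j) / \<beta> $ j)) \<le> V powr 0"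
        using V \<rho>[of j] \<beta>(1)[of j] by (intro powr_mono) auto
      then show "s j \<le> K" using K(2) V by (simp add: s_def mult_left_le)
    qed
    define M where "M j = nat \<lfloor>N / s j\<rfloor>" for j
    \<comment> \<open>The condition \<open>K \<le> N\<close> is used here: a cell is no longer than
      the cube, so every direction holds at least one.\<close>
    have Ns: "1 \<le> N / s j" for j using s[of j] N by simp
    have M: "N / s j / 2 \<le> real (M j)" "0 < M j" "real (M j) \<le> N / s j" for j
      unfolding M_def by (rule nat_floor_ge_half[OF Ns])+
    \<comment> \<open>Any direction may serve as \<open>j0\<close>.\<close>
    interpret bump_lattice k P C N M "undefined :: 'd"
      using P N M by unfold_locales auto
    have WV: "1 \<le> W * V" using W V mult_mono[of 1 W 1 V] by simp
    have base_mem: "base \<in> fclass ((\<beta>', r'), q') (L', Q') \<inter> L2_densities"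
    proof (rule density_mem_fclass[where a = "\<lambda>j. C * (1 / N) powr (\<beta>' $ j)"])
      show "base x \<le> 2 * height" for x using f0_le[of x] height_bounds(1) by simp
      show "base x = 0" if "x \<notin> cbox (\<chi> i. - N) (\<chi> i. 2 * N)" for x
        using plateau_eq_0[OF that] by (simp add: base_def)
      show "\<bar>(fdiff u j ^^ k) base x\<bar> \<le> height * (C * (1 / N) powr (\<beta>' $ j)) * \<bar>u\<bar> powr (\<beta>' $ j)" for u j x
        using fdiff_base_bound[OF \<beta>(2) k(2), of u j x j] powr_mult[of "1 / N" "\<bar>u\<bar>" "\<beta>' $ j"] N(1)
        by (simp add: mult_ac)
      show "C * (1 / N) powr (\<beta>' $ j) / N ^ ?d * (real (k + 1) * 3 ^ ?d * N ^ ?d) powr recip (r' $ j) \<le> L' $ j" for j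
      proof -
        \<comment> \<open>The power of \<open>W * V\<close> is bounded by \<open>W * V\<close>
          itself; V then cancels and the decaying factor \<open>N powr (- \<beta>' $ j)\<close>
          makes the bound small.\<close>
        have "C * (1 / N) powr (\<beta>' $ j) / V * (W * V) powr recip (r' $ j)
            \<le> C * (1 / N) powr (\<beta>' $ j) / V * (W * V)"
          using powr_le_self[OF WV recip_le_1[OF r(2)]] P(7) V by (intro mult_left_mono) auto
        also have "\<dots> = C * W * N powr (- \<beta>' $ j)"
          using V N(1) by (simp add: powr_minus powr_divide inverse_eq_divide)
        also have "\<dots> \<le> L' $ j" using elim by blast
        finally show ?thesis by (simp only: V_def W_def)
      qed
    qed (use r L1 \<beta> k P(7) elim f0_nonneg base_integral measurable_f0 in auto)
    have perturbed_mem: "perturbed w \<in> fclass ((\<beta>, r), q) (L, Q) \<inter> L2_densities" if w: "w \<in> signs" for w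
    proof (rule density_mem_fclass[where a = "\<lambda>j. C1 * (real (M j) / N) powr (\<beta> $ j)"])
      show "\<bar>(fdiff u j ^^ k) (perturbed w) x\<bar>
          \<le> height * (C1 * (real (M j) / N) powr (\<beta> $ j)) * \<bar>u\<bar> powr (\<beta> $ j)" for u j x
        using fdiff_perturbed_bound[OF w \<beta>(1) k(1), of u j x j] N(1)
          powr_mult[of "real (M j) / N" "\<bar>u\<bar>" "\<beta> $ j"]
        by (simp add: C1_def mult_ac)
      show "C1 * (real (M j) / N) powr (\<beta> $ j) / N ^ ?d
          * (real (k + 1) * 3 ^ ?d * N ^ ?d) powr recip (r $ j) \<le> L $ j" for j
      proof -
        have "(real (M j) / N) powr (\<beta> $ j) \<le> (1 / s j) powr (\<beta> $ j)"
          using M(3)[of j] N(1) s(1)[of j] \<beta>(1)[of j]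
          by (intro powr_mono2) (auto simp: field_simps)
        also have "\<dots> = K powr (- \<beta> $ j) * V powr (1 - \<rho> j)"
        proof -
          have "s j powr (\<beta> $ j) = K powr (\<beta> $ j) * V powr (- (1 - \<rho> j))"
            using K(2) V \<beta>(1)[of j] by (simp add: s_def powr_mult powr_powr)
          moreover have "(1 / s j) powr (\<beta> $ j) = inverse (s j powr (\<beta> $ j))"
            using s(1)[of j] by (simp add: powr_divide inverse_eq_divide)
          ultimately show ?thesis
            by (simp only: powr_minus inverse_mult_distrib inverse_inverse_eq)
        qed
        finally have le: "(real (M j) / N) powr (\<beta> $ j) \<le> K powr (- \<beta> $ j) * V powr (1 - \<rho> j)" .
        \<comment> \<open>The exponents of V are 1 - \<rho>, -1 and \<rho>, with sum 0: this balance
          dictates the choice of \<open>s j\<close>.\<close>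
        have "C1 * (real (M j) / N) powr (\<beta> $ j) / V * (W * V) powr \<rho> j
            \<le> C1 * (K powr (- \<beta> $ j) * V powr (1 - \<rho> j)) / V * (W * V) powr \<rho> j"
          using le C1 V by (intro mult_right_mono divide_right_mono mult_left_mono) auto
        also have "\<dots> = C1 * W powr \<rho> j * K powr (- \<beta> $ j)"
          using V W by (simp add: powr_mult powr_diff)
        also have "\<dots> \<le> C1 * W * K powr (- \<beta> $ j)"
          using powr_le_self[OF W \<rho>] C1 by (intro mult_right_mono mult_left_mono) auto
        also have "\<dots> \<le> L $ j" by (rule K)
        finally show ?thesis by (simp only: V_def W_def \<rho>_def)
      qed
    qed (use r L1 \<beta> k C1 elim perturbed_range[OF w] perturbed_integral perturbed_eq_0_outside in auto)
    have cells_ge: "V powr tau (\<beta>, r) 1 / (2 * K) ^ ?d \<le> real (card cells)"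
    proof -
      \<comment> \<open>This uses \<open>recip 1 = 1\<close>. Of V = N^d each direction receives one
        factor N, which forms \<open>N / s j\<close> with the matching power of V; rounding down
        costs at most 2 per direction, whence \<open>(2 * K) ^ ?d\<close>.\<close>
      have "tau (\<beta>, r) 1 = 1 + (\<Sum>j\<in>UNIV. (1 - \<rho> j) / \<beta> $ j)"
        by (simp add: \<rho>_def diff_divide_distrib sum_subtractf)
      then have "V powr tau (\<beta>, r) 1 = V * (\<Prod>j\<in>UNIV. V powr ((1 - \<rho> j) / \<beta> $ j))"
        using V by (simp add: powr_add powr_sum del: tau.simps)
      then have "V powr tau (\<beta>, r) 1 / (2 * K) ^ ?d
          = (\<Prod>j\<in>UNIV. N * V powr ((1 - \<rho> j) / \<beta> $ j) / (2 * K))"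
        by (simp add: prod.distrib prod_dividef V_def del: tau.simps)
      also have "\<dots> = (\<Prod>j\<in>UNIV. N / s j / 2)"
        by (rule prod.cong) (simp_all add: s_def powr_minus field_simps)
      also have "\<dots> \<le> (\<Prod>j\<in>UNIV. real (M j))"
        using M(1) s(1) N_pos by (intro prod_mono) (simp add: less_imp_le)
      finally show ?thesis by (simp add: card_cells)
    qed
    show ?case
    proof (intro allI ballI)
      fix n and T :: "(nat \<Rightarrow> real^'d) \<Rightarrow> real" assume T: "T \<in> estimators n"
      have pos: "0 < V powr tau (\<beta>, r) 1 / (2 * K) ^ ?d" using V K(2) by simp
      have "(real n)\<^sup>2 / real (card cells) \<le> (real n)\<^sup>2 / (V powr tau (\<beta>, r) 1 / (2 * K) ^ ?d)"
        using card_cells_pos by (intro divide_left_mono cells_ge mult_pos_pos pos) simp_all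
      then have exp_le: "exp ((real n)\<^sup>2 / real (card cells))
          \<le> exp ((2 * K) ^ ?d * (real n)\<^sup>2 / V powr tau (\<beta>, r) 1)"
        by (simp add: mult.commute del: tau.simps)
      have "ennreal (3 / 128 / 1728 ^ ?d / N ^ ?d) = ennreal (3 / 128 * (1 / (1728 ^ ?d * N ^ ?d)))"
        by (simp add: mult.assoc)
      also have "\<dots> \<le> ennreal (exp ((real n)\<^sup>2 / real (card cells)))
            * (risk n T (fclass ((\<beta>', r'), q') (L', Q')))\<^sup>2
          + (risk n T (fclass ((\<beta>, r), q) (L, Q)))\<^sup>2"
        by (rule lattice_risk_lower_bound[OF T base_mem perturbed_mem])
      also have "\<dots> \<le> ennreal (exp ((2 * K) ^ ?d * (real n)\<^sup>2 / V powr tau (\<beta>, r) 1))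
            * (risk n T (fclass ((\<beta>', r'), q') (L', Q')))\<^sup>2
          + (risk n T (fclass ((\<beta>, r), q) (L, Q)))\<^sup>2"
        by (intro add_right_mono mult_right_mono ennreal_leI exp_le) simp
      finally show "ennreal (3 / 128 / 1728 ^ ?d / N ^ ?d)
          \<le> ennreal (exp ((2 * K) ^ ?d * (real n)\<^sup>2 / (N ^ ?d) powr tau (\<beta>, r) 1))
            * (risk n T (fclass ((\<beta>', r'), q') (L', Q')))\<^sup>2
          + (risk n T (fclass ((\<beta>, r), q) (L, Q)))\<^sup>2"
        by (simp only: V_def)
    qed
  qed
  then show ?thesis using that[of "3 / 128 / 1728 ^ ?d" "(2 * K) ^ ?d"] K(2) by simp
qed

text \<open>On an empty class every risk is a supremum over the empty set, hence 0, against the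
  positive lower limit.\<close>

lemma exact_minimax_rate_nonempty:
  assumes "exact_minimax_rate F z" shows "F \<inter> L2_densities \<noteq> {}"
proof
  assume empty: "F \<inter> L2_densities = {}"
  have "(INF T\<in>estimators n. risk n T F) = 0" for n
  proof -
    have "(\<lambda>_. 0) \<in> estimators n" by (simp add: estimators_def)
    then have "(INF T\<in>estimators n. risk n T F) \<le> risk n (\<lambda>_. 0) F" by (rule INF_lower)
    then show ?thesis by (simp add: risk_def empty bot_ennreal)
  qed
  then show False using assms by (simp add: exact_minimax_rate_def Liminf_const)
qed

text \<open>For \<open>r $ j = 1\<close> the norm constraint applies to a quantity that is 1 for
  every density, so a single density in the class forces the bound.\<close>

lemma radius_ge_1:
  assumes "fclass ((\<beta>, r), q) (L, Q) \<inter> L2_densities \<noteq> {}" "r $ j = 1"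
  shows "1 \<le> L $ j"
proof -
  obtain f where f: "f \<in> nikolskii \<beta> r L" "f \<in> L2_densities" using assms(1) by auto
  have "Lp_norm 1 f = 1" using f(2) by (intro Lp_norm_1_density) (auto simp: L2_densities_def)
  moreover have "Lp_norm (r $ j) f \<le> ennreal (L $ j)" using f(1) by (simp add: nikolskii_def)
  ultimately have "1 \<le> ennreal (L $ j)" using assms(2) by simp
  then show ?thesis by simp
qed

theorem proposition1:
  fixes \<theta> \<theta>' :: "'d::finite cls_param" and \<theta>b \<theta>b' :: "'d radii" and \<alpha> :: real
  assumes "\<theta> \<in> Theta'"
    and "\<theta>' \<in> Theta'_above \<theta>"
    and "\<alpha> \<in> {rate_exp \<theta> <..< rate_exp \<theta>'}"
    and "\<theta>b \<in> Theta_c" and "\<theta>b' \<in> Theta_c"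
    and "exact_minimax_rate (fclass \<theta> \<theta>b) (rate_exp \<theta>)"
    and "exact_minimax_rate (fclass \<theta>' \<theta>b') (rate_exp \<theta>')"
  shows "0 < liminf (\<lambda>n. INF T\<in>estimators n.
           ennreal (real n powr (2 * \<alpha>)) * (risk n T (fclass \<theta>' \<theta>b'))\<^sup>2
           + ennreal ((sqrt (ln (real n)) / real n) powr (- 2 * rate_exp \<theta>))
             * (risk n T (fclass \<theta> \<theta>b))\<^sup>2)"
proof -
  let ?d = "CARD('d)"
  obtain \<beta> r q L Q where \<theta>: "\<theta> = ((\<beta>, r), q)" "\<theta>b = (L, Q)" by (metis prod.exhaust)
  obtain \<beta>' r' q' L' Q' where \<theta>': "\<theta>' = ((\<beta>', r'), q')" "\<theta>b' = (L', Q')" by (metis prod.exhaust)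
  have mem: "((\<beta>, r), q) \<in> Theta_r" "((\<beta>', r'), q') \<in> Theta_r" "(L, Q) \<in> Theta_c" "(L', Q') \<in> Theta_c"
    "1 \<le> tau (\<beta>, r) 2" "2 < tau (\<beta>, r) 1"
    using assms(1,2,4,5) by (auto simp: Theta'_def Theta'_above_def \<theta> \<theta>')
  define t where "t = tau (\<beta>, r) 1"
  define z where "z = 1 / t"
  have t: "2 < t" using mem by (simp add: t_def)
  \<comment> \<open>Since \<open>2 < t\<close>, the minimum in the exponent is 1/t.\<close>
  have z: "0 < z" "rate_exp \<theta> = z" using mem t by (auto simp: z_def t_def \<theta> min_def field_simps)
  \<comment> \<open>The exponent by which n^(2\<alpha>) exceeds n^(2z).\<close>
  define \<kappa> where "\<kappa> = 2 * (\<alpha> - z)"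
  have \<kappa>: "0 < \<kappa>" using assms(3) z(2) by (simp add: \<kappa>_def)
  obtain c1 c2 where c: "0 < c1" "0 < c2" and bound:
    "\<forall>\<^sub>F N in at_top. \<forall>n. \<forall>T\<in>estimators n. ennreal (c1 / N ^ ?d)
      \<le> ennreal (exp (c2 * (real n)\<^sup>2 / (N ^ ?d) powr t)) * (risk n T (fclass \<theta>' \<theta>b'))\<^sup>2
        + (risk n T (fclass \<theta> \<theta>b))\<^sup>2"
    unfolding \<theta> \<theta>' t_def
  proof (rule risk_lower_bound_large_volume[of \<beta> \<beta>' r r' q q' L L' Q Q'])
    show "1 \<le> L $ j" if "r $ j = 1" for j
      using exact_minimax_rate_nonempty[OF assms(6)] that unfolding \<theta> by (rule radius_ge_1)
    show "1 \<le> L' $ j" if "r' $ j = 1" for j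
      using exact_minimax_rate_nonempty[OF assms(7)] that unfolding \<theta>' by (rule radius_ge_1)
  qed (use mem in \<open>auto simp: Theta_r_def Theta_c_def\<close>)
  \<comment> \<open>The solution of c2 n^2/V^t = \<kappa> ln n; the bound for the second moment is
    then exactly n^\<kappa>.\<close>
  define V where "V n = (c2 / \<kappa> * ((real n)\<^sup>2 / ln (real n))) powr z" for n
  have powr_lim: "filterlim (\<lambda>x::real. x powr a) at_top at_top" if "0 < a" for a
    using that by real_asymp
  define side where "side n = V n powr (1 / ?d)" for n
  have V_lim: "filterlim V at_top sequentially"
  proof -
    have "filterlim (\<lambda>n. (real n)\<^sup>2 / ln (real n)) at_top sequentially" by real_asymp
    then have "filterlim (\<lambda>n. c2 / \<kappa> * ((real n)\<^sup>2 / ln (real n))) at_top sequentially"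
      using c \<kappa> by (intro filterlim_tendsto_pos_mult_at_top[OF tendsto_const]) auto
    then show ?thesis unfolding V_def
      by (rule filterlim_compose[OF powr_lim[OF z(1)]])
  qed
  have "filterlim side at_top sequentially"
    unfolding side_def by (rule filterlim_compose[OF powr_lim V_lim]) simp
  \<comment> \<open>The bound holds for all sample sizes at once as soon as the side is large, so
    the side may be tied to n.\<close>
  from eventually_compose_filterlim[OF bound this]
  have ev: "\<forall>\<^sub>F n in sequentially. \<forall>m. \<forall>T\<in>estimators m. ennreal (c1 / side n ^ ?d)
      \<le> ennreal (exp (c2 * (real m)\<^sup>2 / (side n ^ ?d) powr t)) * (risk m T (fclass \<theta>' \<theta>b'))\<^sup>2
        + (risk m T (fclass \<theta> \<theta>b))\<^sup>2" .
  define c0 where "c0 = c1 * (\<kappa> / c2) powr z"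
  have c0: "0 < c0" using c \<kappa> by (simp add: c0_def)
  have "\<forall>\<^sub>F n in sequentially. ennreal c0 \<le> (INF T\<in>estimators n.
           ennreal (real n powr (2 * \<alpha>)) * (risk n T (fclass \<theta>' \<theta>b'))\<^sup>2
           + ennreal ((sqrt (ln (real n)) / real n) powr (- 2 * rate_exp \<theta>))
             * (risk n T (fclass \<theta> \<theta>b))\<^sup>2)"
    using ev eventually_ge_at_top[of 3]
  proof eventually_elim
    case (elim n)
    define y where "y = (real n)\<^sup>2 / ln (real n)"
    have n: "3 \<le> real n" using elim(2) by simp
    have ln: "1 \<le> ln (real n)"
    proof -
      \<comment> \<open>The threshold 3 is there because e \<le> 3.\<close>
      have "exp 1 \<le> real n" using exp_le n by linarith
      then show ?thesis using n by (simp add: ln_ge_iff)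
    qed
    have y: "0 < y" using n ln by (simp add: y_def)
    have V: "V n = (c2 / \<kappa>) powr z * y powr z"
      unfolding V_def y_def[symmetric] by (rule powr_mult)
    have Vpos: "0 < V n" using V c \<kappa> y by simp
    have side: "side n ^ ?d = V n"
      using Vpos by (simp add: side_def powr_powr flip: powr_realpow)
    have "V n powr t = c2 / \<kappa> * y"
      unfolding V_def y_def[symmetric] using c \<kappa> y t by (simp add: powr_powr z_def)
    then have "c2 * (real n)\<^sup>2 / V n powr t = \<kappa> * ln (real n)"
      using c \<kappa> n ln by (simp only:) (simp add: y_def field_simps)
    then have exp_eq: "exp (c2 * (real n)\<^sup>2 / V n powr t) = real n powr \<kappa>"
      using n by (simp add: powr_def)
    have rate: "(sqrt (ln (real n)) / real n) powr (- 2 * rate_exp \<theta>) = y powr z"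
    proof -
      have "(sqrt (ln (real n)) / real n) powr (- 2 * z)
          = ((sqrt (ln (real n)) / real n) powr 2) powr (- z)"
        by (simp add: powr_powr)
      also have "(sqrt (ln (real n)) / real n) powr 2 = ln (real n) / (real n)\<^sup>2"
        using n ln by (simp add: power_divide)
      also have "\<dots> powr (- z) = y powr z"
        using n ln by (simp add: y_def powr_minus powr_divide inverse_eq_divide)
      finally show ?thesis by (simp add: z(2))
    qed
    have "y powr z * real n powr \<kappa> \<le> real n powr (2 * \<alpha>)"
    proof -
      \<comment> \<open>From ln n \<ge> 1: on the \<theta>' side the logarithm is given
        away.\<close>
      have "y \<le> (real n)\<^sup>2" using ln by (simp add: y_def divide_le_eq mult_le_cancel_left1)
      then have "y powr z \<le> ((real n)\<^sup>2) powr z" using y z(1) by (intro powr_mono2) auto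
      also have "\<dots> = real n powr (2 * z)" using n by (simp add: powr_powr flip: powr_numeral)
      finally have "y powr z * real n powr \<kappa> \<le> real n powr (2 * z) * real n powr \<kappa>"
        by (rule mult_right_mono) simp
      also have "\<dots> = real n powr (2 * \<alpha>)" by (simp add: \<kappa>_def algebra_simps flip: powr_add)
      finally show ?thesis .
    qed
    then have weight: "ennreal (y powr z) * ennreal (real n powr \<kappa>) \<le> ennreal (real n powr (2 * \<alpha>))"
      by (simp add: ennreal_leI flip: ennreal_mult)
    \<comment> \<open>The weight \<open>y powr z\<close> and the separation c1/V n are exactly
      reciprocal in order, so their product does not depend on n.\<close>
    have c0_eq: "c0 = y powr z * (c1 / V n)"
      using c \<kappa> y by (simp add: c0_def V powr_divide)
    show ?case
    proof (rule INF_greatest)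
      fix T :: "(nat \<Rightarrow> real^'d) \<Rightarrow> real" assume "T \<in> estimators n"
      then have "ennreal (c1 / V n) \<le> ennreal (real n powr \<kappa>) * (risk n T (fclass \<theta>' \<theta>b'))\<^sup>2
          + (risk n T (fclass \<theta> \<theta>b))\<^sup>2"
        using elim(1) unfolding side exp_eq[symmetric] by blast
      then have "ennreal (y powr z) * ennreal (c1 / V n)
          \<le> ennreal (y powr z) * (ennreal (real n powr \<kappa>) * (risk n T (fclass \<theta>' \<theta>b'))\<^sup>2
            + (risk n T (fclass \<theta> \<theta>b))\<^sup>2)"
        by (rule mult_left_mono) simp
      also have "\<dots> = ennreal (y powr z) * ennreal (real n powr \<kappa>) * (risk n T (fclass \<theta>' \<theta>b'))\<^sup>2
          + ennreal (y powr z) * (risk n T (fclass \<theta> \<theta>b))\<^sup>2"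
        by (simp add: distrib_left mult.assoc)
      also have "\<dots> \<le> ennreal (real n powr (2 * \<alpha>)) * (risk n T (fclass \<theta>' \<theta>b'))\<^sup>2
          + ennreal (y powr z) * (risk n T (fclass \<theta> \<theta>b))\<^sup>2"
        by (intro add_right_mono mult_right_mono weight) simp
      finally show "ennreal c0 \<le> ennreal (real n powr (2 * \<alpha>)) * (risk n T (fclass \<theta>' \<theta>b'))\<^sup>2
           + ennreal ((sqrt (ln (real n)) / real n) powr (- 2 * rate_exp \<theta>))
             * (risk n T (fclass \<theta> \<theta>b))\<^sup>2"
        unfolding rate c0_eq by (subst ennreal_mult') simp_all
    qed
  qed
  then have "ennreal c0 \<le> liminf (\<lambda>n. INF T\<in>estimators n.
           ennreal (real n powr (2 * \<alpha>)) * (risk n T (fclass \<theta>' \<theta>b'))\<^sup>2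
           + ennreal ((sqrt (ln (real n)) / real n) powr (- 2 * rate_exp \<theta>))
             * (risk n T (fclass \<theta> \<theta>b))\<^sup>2)"
    by (rule Liminf_bounded)
  then show ?thesis using c0 by (auto intro: less_le_trans[of _ "ennreal c0"])
qed

end
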